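(* Let $R$ be a ring and let $M$ be a left $R$-module which is projective in $\sigma[M]$. If $M$ is co-semisimple and a Goldie module, then the maximal fully invariant submodules of $M$ (i.e. the maximal elements among the proper fully invariant submodules) are exactly the minimal prime in $M$ submodules. Moreover, if $P_1,\dots,P_n$ are the minimal prime in $M$ submodules, then $\mathrm{Spec}(M)=\{P_1,\dots,P_n\}$, where $\mathrm{Spec}(M)$ is the set of all prime in $M$ submodules.
   Context: Rings are associative with unit and modules are left unital modules. $\sigma[M]$ is the full subcategory of $R$-Mod of $M$-subgenerated modules (submodules of quotients of direct sums of copies of $M$). "Projective in $\sigma[M]$" means that $\mathrm{Hom}_R(M,-)$ is exact on short exact sequences in $\sigma[M]$. A module $A$ is $M$-injective if every homomorphism from a submodule of $M$ to $A$ extends to $M$. $M$ is co-semisimple if every simple module in $\sigma[M]$ is $M$-injective. A submodule $N\le M$ is fully invariant, $N\leq_{FI}M$, if $f(N)\le N$ for all $f\in \mathrm{End}_R(M)$. For $N,K\le M$, the product is $N_MK=\sum\{f(N)\mid f\in \mathrm{Hom}_R(M,K)\}$. A proper submodule $P\leq_{FI}M$ is prime in $M$ if whenever $N,K\leq_{FI}M$ and $N_MK\le P$, then $N\le P$ or $K\le P$; the minimal prime in $M$ submodules are the minimal elements (under inclusion) of the set of prime in $M$ submodules. A left annihilator in $M$ is a submodule of the form $\bigcap_{f\in X}\mathrm{Ker}(f)$ for some $X\subseteq \mathrm{End}_R(M)$. $M$ is a Goldie module if it satisfies ACC on left annihilators and has finite uniform dimension. *)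

theory Defs
  imports "HOL-Algebra.Module" "HOL-Algebra.AbelCoset"
begin

section \<open>Left modules over a ring\<close>

text \<open>The locale \<^locale>\<open>module\<close> requires a commutative ring of scalars. Here the scalars form
  an arbitrary (associative, unital) ring. The records, and the generic locale
  \<^locale>\<open>submodule\<close>, are those of the library; the multiplicative fields of a module record are
  irrelevant.\<close>

locale left_module = R?: ring R + M?: abelian_group M 
    for R :: "('r, 'x) ring_scheme" (structure) and M :: "('r, 'm, 'y) module_scheme" (structure) +
  assumes smult_closed [simp, intro]:
      "\<lbrakk>a \<in> carrier R; x \<in> carrier M\<rbrakk> \<Longrightarrow> a \<odot>\<^bsub>M\<^esub> x \<in> carrier M"
    and smult_l_distr:
      "\<lbrakk>a \<in> carrier R; b \<in> carrier R; x \<in> carrier M\<rbrakk> \<Longrightarrow>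
        (a \<oplus>\<^bsub>R\<^esub> b) \<odot>\<^bsub>M\<^esub> x = a \<odot>\<^bsub>M\<^esub> x \<oplus>\<^bsub>M\<^esub> b \<odot>\<^bsub>M\<^esub> x"
    and smult_r_distr:
      "\<lbrakk>a \<in> carrier R; x \<in> carrier M; y \<in> carrier M\<rbrakk> \<Longrightarrow>
        a \<odot>\<^bsub>M\<^esub> (x \<oplus>\<^bsub>M\<^esub> y) = a \<odot>\<^bsub>M\<^esub> x \<oplus>\<^bsub>M\<^esub> a \<odot>\<^bsub>M\<^esub> y"
    and smult_assoc:
      "\<lbrakk>a \<in> carrier R; b \<in> carrier R; x \<in> carrier M\<rbrakk> \<Longrightarrow>
        (a \<otimes>\<^bsub>R\<^esub> b) \<odot>\<^bsub>M\<^esub> x = a \<odot>\<^bsub>M\<^esub> (b \<odot>\<^bsub>M\<^esub> x)"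
    and smult_one [simp]: "x \<in> carrier M \<Longrightarrow> \<one>\<^bsub>R\<^esub> \<odot>\<^bsub>M\<^esub> x = x"

text \<open>Homomorphisms are extensional functions, so that equality of homomorphisms is equality
  of functions and composition is \<^const>\<open>compose\<close>.\<close>

definition Hom :: "('r, 'x) ring_scheme \<Rightarrow> ('r, 'a) module \<Rightarrow> ('r, 'b) module \<Rightarrow> ('a \<Rightarrow> 'b) set"
  where "Hom R A B = {f \<in> carrier A \<rightarrow>\<^sub>E carrier B.
    (\<forall>x\<in>carrier A. \<forall>y\<in>carrier A. f (x \<oplus>\<^bsub>A\<^esub> y) = f x \<oplus>\<^bsub>B\<^esub> f y) \<and>
    (\<forall>r\<in>carrier R. \<forall>x\<in>carrier A. f (r \<odot>\<^bsub>A\<^esub> x) = r \<odot>\<^bsub>B\<^esub> f x)}"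

definition restrict_module :: "('r, 'a) module \<Rightarrow> 'a set \<Rightarrow> ('r, 'a) module"
  where "restrict_module M N = M\<lparr>carrier := N\<rparr>"

definition quotient_module :: "('r, 'a) module \<Rightarrow> 'a set \<Rightarrow> ('r, 'a set) module"
  where "quotient_module M K =
    \<lparr>carrier = a_rcosets\<^bsub>M\<^esub> K, mult = undefined, one = undefined, zero = K,
     add = set_add M, smult = (\<lambda>r C. \<Union>x\<in>C. K +>\<^bsub>M\<^esub> (r \<odot>\<^bsub>M\<^esub> x))\<rparr>"

text \<open>The direct sum of copies of \<open>M\<close> indexed by \<open>I\<close>: finitely supported families.\<close>

definition direct_power :: "'i set \<Rightarrow> ('r, 'a) module \<Rightarrow> ('r, 'i \<Rightarrow> 'a) module"
  where "direct_power I M =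
    \<lparr>carrier = {x \<in> I \<rightarrow>\<^sub>E carrier M. finite {i \<in> I. x i \<noteq> \<zero>\<^bsub>M\<^esub>}},
     mult = undefined, one = undefined,
     zero = (\<lambda>i\<in>I. \<zero>\<^bsub>M\<^esub>), add = (\<lambda>x y. \<lambda>i\<in>I. x i \<oplus>\<^bsub>M\<^esub> y i),
     smult = (\<lambda>r x. \<lambda>i\<in>I. r \<odot>\<^bsub>M\<^esub> x i)\<rparr>"

definition simple_module :: "('r, 'x) ring_scheme \<Rightarrow> ('r, 'a) module \<Rightarrow> bool"
  where "simple_module R S \<longleftrightarrow> left_module R S \<and> carrier S \<noteq> {\<zero>\<^bsub>S\<^esub>} \<and>
    (\<forall>N. submodule N R S \<longrightarrow> N = {\<zero>\<^bsub>S\<^esub>} \<or> N = carrier S)"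

definition sum_submodules :: "('r, 'a) module \<Rightarrow> 'i set \<Rightarrow> ('i \<Rightarrow> 'a set) \<Rightarrow> 'a set"
  where "sum_submodules M I N =
    {finsum M x F | x F. finite F \<and> F \<subseteq> I \<and> (\<forall>i\<in>F. x i \<in> N i)}"


section \<open>The category \<open>\<sigma>[M]\<close>\<close>

text \<open>\<open>A\<close> belongs to \<open>\<sigma>[M]\<close> if it is isomorphic to a submodule of (i.e. embeds into) a quotient
  of a direct sum of copies of \<open>M\<close>. Letting the index sets range over
  \<open>('u \<times> nat) set\<close> loses nothing: if \<open>A\<close> embeds into \<open>M\<^sup>(\<^sup>I\<^sup>)/K\<close>, choose a representative in
  \<open>M\<^sup>(\<^sup>I\<^sup>)\<close> for the image of each element of \<open>A\<close> and let \<open>J\<close> be the union of their finite supports;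
  then \<open>A\<close> embeds into \<open>M\<^sup>(\<^sup>J\<^sup>)/(K \<inter> M\<^sup>(\<^sup>J\<^sup>))\<close>, and \<open>J\<close> is at most as large as \<open>'u \<times> nat\<close>.\<close>

definition in_sigma :: "('r, 'x) ring_scheme \<Rightarrow> ('r, 'm) module \<Rightarrow> ('r, 'u) module \<Rightarrow> bool"
  where "in_sigma R M A \<longleftrightarrow> left_module R A \<and>
    (\<exists>(I :: ('u \<times> nat) set) K f.
       submodule K R (direct_power I M) \<and>
       f \<in> Hom R A (quotient_module (direct_power I M) K) \<and> inj_on f (carrier A))"

definition short_exact ::
    "('r, 'x) ring_scheme \<Rightarrow> ('r, 'a) module \<Rightarrow> ('r, 'b) module \<Rightarrow> ('r, 'c) module \<Rightarrow>
      ('a \<Rightarrow> 'b) \<Rightarrow> ('b \<Rightarrow> 'c) \<Rightarrow> bool"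
  where "short_exact R A B C f g \<longleftrightarrow> f \<in> Hom R A B \<and> g \<in> Hom R B C \<and>
    inj_on f (carrier A) \<and> f ` carrier A = a_kernel B C g \<and> g ` carrier B = carrier C"

text \<open>The two notions below quantify over all modules of \<open>\<sigma>[M]\<close> whose carrier is a set of elements
  of a type \<open>'u\<close>, which is passed explicitly. They agree with the notions quantifying over all
  modules whatsoever as soon as \<open>'u\<close> is infinite and at least as large as \<open>carrier M\<close>
  (the case \<open>M = 0\<close>, where \<open>\<sigma>[M]\<close> consists of zero modules, being trivial for any \<open>'u\<close>):

  \<^item> a cyclic module \<open>Rx\<close> in \<open>\<sigma>[M]\<close> is a quotient of a submodule of some \<open>M\<^sup>k\<close>, \<open>k\<close> finite, hence
    has at most \<open>max |M| \<aleph>\<^sub>0\<close> elements; in particular so does every simple module in \<open>\<sigma>[M]\<close>;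

  \<^item> to lift \<open>h : M \<rightarrow> C\<close> along an epimorphism \<open>g : B \<rightarrow> C\<close> in \<open>\<sigma>[M]\<close> (left exactness of \<open>Hom\<close> is
    automatic) one may replace \<open>B\<close> by the submodule generated by one \<open>g\<close>-preimage of each element
    of \<open>h(M)\<close>, and \<open>C\<close> by \<open>h(M)\<close>; both have at most \<open>max |M| \<aleph>\<^sub>0\<close> elements.\<close>

definition projective_in_sigma ::
    "'u itself \<Rightarrow> ('r, 'x) ring_scheme \<Rightarrow> ('r, 'm) module \<Rightarrow> bool"
  where "projective_in_sigma (_ :: 'u itself) R M \<longleftrightarrow>
    (\<forall>(A :: ('r, 'u) module) (B :: ('r, 'u) module) (C :: ('r, 'u) module) f g.
       in_sigma R M A \<and> in_sigma R M B \<and> in_sigma R M C \<and> short_exact R A B C f g \<longrightarrow>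
         inj_on (compose (carrier M) f) (Hom R M A) \<and>
         compose (carrier M) f ` Hom R M A =
           {h \<in> Hom R M B. compose (carrier M) g h = (\<lambda>x\<in>carrier M. \<zero>\<^bsub>C\<^esub>)} \<and>
         compose (carrier M) g ` Hom R M B = Hom R M C)"

definition M_injective :: "('r, 'x) ring_scheme \<Rightarrow> ('r, 'm) module \<Rightarrow> ('r, 'a) module \<Rightarrow> bool"
  where "M_injective R M A \<longleftrightarrow>
    (\<forall>N f. submodule N R M \<and> f \<in> Hom R (restrict_module M N) A \<longrightarrow>
       (\<exists>g\<in>Hom R M A. \<forall>x\<in>N. g x = f x))"

definition co_semisimple :: "'u itself \<Rightarrow> ('r, 'x) ring_scheme \<Rightarrow> ('r, 'm) module \<Rightarrow> bool"
  where "co_semisimple (_ :: 'u itself) R M \<longleftrightarrow>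
    (\<forall>S :: ('r, 'u) module. in_sigma R M S \<and> simple_module R S \<longrightarrow> M_injective R M S)"


section \<open>Fully invariant and prime submodules\<close>

definition fully_invariant :: "('r, 'x) ring_scheme \<Rightarrow> ('r, 'm) module \<Rightarrow> 'm set \<Rightarrow> bool"
  where "fully_invariant R M N \<longleftrightarrow> submodule N R M \<and> (\<forall>f\<in>Hom R M M. f ` N \<subseteq> N)"

definition maximal_fully_invariant :: "('r, 'x) ring_scheme \<Rightarrow> ('r, 'm) module \<Rightarrow> 'm set set"
  where "maximal_fully_invariant R M =
    {N. fully_invariant R M N \<and> N \<noteq> carrier M \<and>
        (\<forall>K. fully_invariant R M K \<and> K \<noteq> carrier M \<and> N \<subseteq> K \<longrightarrow> K = N)}"

definition module_prod :: "('r, 'x) ring_scheme \<Rightarrow> ('r, 'm) module \<Rightarrow> 'm set \<Rightarrow> 'm set \<Rightarrow> 'm set"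
  where "module_prod R M N K =
    sum_submodules M (Hom R M (restrict_module M K)) (\<lambda>f. f ` N)"

definition prime_in :: "('r, 'x) ring_scheme \<Rightarrow> ('r, 'm) module \<Rightarrow> 'm set \<Rightarrow> bool"
  where "prime_in R M P \<longleftrightarrow> fully_invariant R M P \<and> P \<noteq> carrier M \<and>
    (\<forall>N K. fully_invariant R M N \<and> fully_invariant R M K \<and> module_prod R M N K \<subseteq> P \<longrightarrow>
       N \<subseteq> P \<or> K \<subseteq> P)"

definition Spec_module :: "('r, 'x) ring_scheme \<Rightarrow> ('r, 'm) module \<Rightarrow> 'm set set"
  where "Spec_module R M = {P. prime_in R M P}"

definition minimal_primes :: "('r, 'x) ring_scheme \<Rightarrow> ('r, 'm) module \<Rightarrow> 'm set set"
  where "minimal_primes R M =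
    {P \<in> Spec_module R M. \<forall>Q\<in>Spec_module R M. Q \<subseteq> P \<longrightarrow> Q = P}"


section \<open>Goldie modules\<close>

definition left_annihilator_in :: "('r, 'x) ring_scheme \<Rightarrow> ('r, 'm) module \<Rightarrow> 'm set \<Rightarrow> bool"
  where "left_annihilator_in R M N \<longleftrightarrow>
    (\<exists>F\<subseteq>Hom R M M. N = {m \<in> carrier M. \<forall>f\<in>F. f m = \<zero>\<^bsub>M\<^esub>})"

definition ACC_left_annihilators :: "('r, 'x) ring_scheme \<Rightarrow> ('r, 'm) module \<Rightarrow> bool"
  where "ACC_left_annihilators R M \<longleftrightarrow>
    (\<forall>N :: nat \<Rightarrow> 'm set. (\<forall>i. left_annihilator_in R M (N i)) \<and> (\<forall>i. N i \<subseteq> N (Suc i)) \<longrightarrow>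
       (\<exists>k. \<forall>i\<ge>k. N i = N k))"

text \<open>Finite uniform (Goldie) dimension: \<open>M\<close> contains no infinite direct sum of nonzero
  submodules.\<close>

definition finite_uniform_dimension :: "('r, 'x) ring_scheme \<Rightarrow> ('r, 'm) module \<Rightarrow> bool"
  where "finite_uniform_dimension R M \<longleftrightarrow>
    \<not> (\<exists>U :: nat \<Rightarrow> 'm set. (\<forall>i. submodule (U i) R M \<and> U i \<noteq> {\<zero>\<^bsub>M\<^esub>}) \<and>
         (\<forall>i. U i \<inter> sum_submodules M (- {i}) U = {\<zero>\<^bsub>M\<^esub>}))"

definition Goldie_module :: "('r, 'x) ring_scheme \<Rightarrow> ('r, 'm) module \<Rightarrow> bool"
  where "Goldie_module R M \<longleftrightarrow> ACC_left_annihilators R M \<and> finite_uniform_dimension R M"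

end

theory Submission
  imports Defs
begin

text \<open>
  Co-semisimplicity separates an element of \<open>M\<close> from a submodule not containing it by a homomorphism
  to an \<open>M\<close>-injective simple module \<open>S\<close>. Lifting such maps by projectivity shows, first, that
  every \<open>x \<in> N \<le> M\<close> lies in the submodule generated by all \<open>\<phi>(x)\<close> with \<open>\<phi> : M \<rightarrow> N\<close> and, secondly, that
  a fully invariant \<open>I\<close> containing the image of a monomorphism \<open>f : M \<rightarrow> M\<close> is all of \<open>M\<close>: given a nonzero
  \<open>\<pi> : M \<rightarrow> S\<close> vanishing on \<open>I\<close>, extend \<open>f(m) \<mapsto> \<pi>(m)\<close> to \<open>h : M \<rightarrow> S\<close> and write \<open>h = \<pi> \<phi>\<close>; then
  \<open>\<pi>(m) = \<pi>(\<phi>(f(m))) \<in> \<pi>(I) = 0\<close>.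

  By Goldie's argument every essential fully invariant submodule contains such an image, so it equals \<open>M\<close>.
  If \<open>I\<close> is fully invariant and \<open>J\<close> is the common kernel of all maps \<open>M \<rightarrow> I\<close>, then \<open>I \<oplus> J\<close> is essential,
  whence \<open>M = I \<oplus> J\<close>. Therefore primes are maximal fully invariant, and finite uniform
  dimension leaves only finitely many of them, since their complements form a direct sum.
\<close>

section \<open>Submodules and homomorphisms\<close>

text \<open>Additive inverses come from scaling by -1: \<open>zero\<close> turns (-1)x + x = (-1 +
  1)x into the zero element. The constructions below thus never exhibit negatives.\<close>

lemma left_moduleI:
  assumes "ring R"
    and "\<zero>\<^bsub>A\<^esub> \<in> carrier A"
    and "\<And>x y. \<lbrakk>x \<in> carrier A; y \<in> carrier A\<rbrakk> \<Longrightarrow> x \<oplus>\<^bsub>A\<^esub> y \<in> carrier A"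
    and "\<And>r x. \<lbrakk>r \<in> carrier R; x \<in> carrier A\<rbrakk> \<Longrightarrow> r \<odot>\<^bsub>A\<^esub> x \<in> carrier A"
    and "\<And>x y z. \<lbrakk>x \<in> carrier A; y \<in> carrier A; z \<in> carrier A\<rbrakk> \<Longrightarrow>
      (x \<oplus>\<^bsub>A\<^esub> y) \<oplus>\<^bsub>A\<^esub> z = x \<oplus>\<^bsub>A\<^esub> (y \<oplus>\<^bsub>A\<^esub> z)"
    and "\<And>x y. \<lbrakk>x \<in> carrier A; y \<in> carrier A\<rbrakk> \<Longrightarrow> x \<oplus>\<^bsub>A\<^esub> y = y \<oplus>\<^bsub>A\<^esub> x"
    and "\<And>x. x \<in> carrier A \<Longrightarrow> \<zero>\<^bsub>A\<^esub> \<oplus>\<^bsub>A\<^esub> x = x"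
    and zero: "\<And>x. x \<in> carrier A \<Longrightarrow> \<zero>\<^bsub>R\<^esub> \<odot>\<^bsub>A\<^esub> x = \<zero>\<^bsub>A\<^esub>"
    and one: "\<And>x. x \<in> carrier A \<Longrightarrow> \<one>\<^bsub>R\<^esub> \<odot>\<^bsub>A\<^esub> x = x"
    and dist: "\<And>r s x. \<lbrakk>r \<in> carrier R; s \<in> carrier R; x \<in> carrier A\<rbrakk> \<Longrightarrow>
      (r \<oplus>\<^bsub>R\<^esub> s) \<odot>\<^bsub>A\<^esub> x = r \<odot>\<^bsub>A\<^esub> x \<oplus>\<^bsub>A\<^esub> s \<odot>\<^bsub>A\<^esub> x"
    and "\<And>r x y. \<lbrakk>r \<in> carrier R; x \<in> carrier A; y \<in> carrier A\<rbrakk> \<Longrightarrow>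
      r \<odot>\<^bsub>A\<^esub> (x \<oplus>\<^bsub>A\<^esub> y) = r \<odot>\<^bsub>A\<^esub> x \<oplus>\<^bsub>A\<^esub> r \<odot>\<^bsub>A\<^esub> y"
    and "\<And>r s x. \<lbrakk>r \<in> carrier R; s \<in> carrier R; x \<in> carrier A\<rbrakk> \<Longrightarrow>
      (r \<otimes>\<^bsub>R\<^esub> s) \<odot>\<^bsub>A\<^esub> x = r \<odot>\<^bsub>A\<^esub> (s \<odot>\<^bsub>A\<^esub> x)"
  shows "left_module R A"
proof (intro left_module.intro left_module_axioms.intro abelian_groupI)
  interpret R: ring R by fact
  fix x assume x: "x \<in> carrier A"
  have "(\<ominus>\<^bsub>R\<^esub> \<one>\<^bsub>R\<^esub>) \<odot>\<^bsub>A\<^esub> x \<oplus>\<^bsub>A\<^esub> x = (\<ominus>\<^bsub>R\<^esub> \<one>\<^bsub>R\<^esub> \<oplus>\<^bsub>R\<^esub> \<one>\<^bsub>R\<^esub>) \<odot>\<^bsub>A\<^esub> x"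
    using x by (simp add: dist one del: R.l_neg)
  then have "(\<ominus>\<^bsub>R\<^esub> \<one>\<^bsub>R\<^esub>) \<odot>\<^bsub>A\<^esub> x \<oplus>\<^bsub>A\<^esub> x = \<zero>\<^bsub>A\<^esub>"
    using x by (simp add: zero R.l_neg)
  then show "\<exists>y\<in>carrier A. y \<oplus>\<^bsub>A\<^esub> x = \<zero>\<^bsub>A\<^esub>"
    using x assms(4)[of "\<ominus>\<^bsub>R\<^esub> \<one>\<^bsub>R\<^esub>"] by auto
qed (rule assms; assumption)+

section \<open>Scalar arithmetic and submodules of a left module\<close>

context left_module
begin

lemma smult_zero_left [simp]:
  assumes "x \<in> carrier M" shows "\<zero>\<^bsub>R\<^esub> \<odot>\<^bsub>M\<^esub> x = \<zero>\<^bsub>M\<^esub>"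
proof -
  have "\<zero>\<^bsub>R\<^esub> \<odot>\<^bsub>M\<^esub> x \<oplus>\<^bsub>M\<^esub> \<zero>\<^bsub>R\<^esub> \<odot>\<^bsub>M\<^esub> x = \<zero>\<^bsub>R\<^esub> \<odot>\<^bsub>M\<^esub> x"
    using assms smult_l_distr[of "\<zero>\<^bsub>R\<^esub>" "\<zero>\<^bsub>R\<^esub>" x] by simp
  then show ?thesis
    using assms M.add.l_cancel_one smult_closed by blast
qed

lemma smult_minus_one:
  assumes "x \<in> carrier M" shows "(\<ominus>\<^bsub>R\<^esub> \<one>\<^bsub>R\<^esub>) \<odot>\<^bsub>M\<^esub> x = \<ominus>\<^bsub>M\<^esub> x"
proof -
  have "(\<ominus>\<^bsub>R\<^esub> \<one>\<^bsub>R\<^esub>) \<odot>\<^bsub>M\<^esub> x \<oplus>\<^bsub>M\<^esub> x = \<zero>\<^bsub>M\<^esub>"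
    using assms smult_l_distr[of "\<ominus>\<^bsub>R\<^esub> \<one>\<^bsub>R\<^esub>" "\<one>\<^bsub>R\<^esub>" x] by (simp add: R.l_neg)
  then show ?thesis
    using assms by (metis M.minus_equality R.a_inv_closed R.one_closed smult_closed)
qed

lemma smult_zero_right [simp]:
  assumes "r \<in> carrier R" shows "r \<odot>\<^bsub>M\<^esub> \<zero>\<^bsub>M\<^esub> = \<zero>\<^bsub>M\<^esub>"
proof -
  have "r \<odot>\<^bsub>M\<^esub> \<zero>\<^bsub>M\<^esub> \<oplus>\<^bsub>M\<^esub> r \<odot>\<^bsub>M\<^esub> \<zero>\<^bsub>M\<^esub> = r \<odot>\<^bsub>M\<^esub> \<zero>\<^bsub>M\<^esub>"
    using assms smult_r_distr[of r "\<zero>\<^bsub>M\<^esub>" "\<zero>\<^bsub>M\<^esub>"] by simp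
  then show ?thesis
    using assms M.add.l_cancel_one smult_closed by blast
qed

lemma submoduleI:
  assumes "N \<subseteq> carrier M" "\<zero>\<^bsub>M\<^esub> \<in> N"
    and "\<And>x y. \<lbrakk>x \<in> N; y \<in> N\<rbrakk> \<Longrightarrow> x \<oplus>\<^bsub>M\<^esub> y \<in> N"
    and smult: "\<And>r x. \<lbrakk>r \<in> carrier R; x \<in> N\<rbrakk> \<Longrightarrow> r \<odot>\<^bsub>M\<^esub> x \<in> N"
  shows "submodule N R M"
proof (intro submodule.intro subgroup.intro submodule_axioms.intro)
  fix x assume "x \<in> N"
  then show "inv\<^bsub>add_monoid M\<^esub> x \<in> N"
    using smult[of "\<ominus>\<^bsub>R\<^esub> \<one>\<^bsub>R\<^esub>" x] smult_minus_one[of x] assms(1) by (auto simp: a_inv_def)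
qed (use assms in auto)

lemma
  assumes "submodule N R M"
  shows submodule_subset: "N \<subseteq> carrier M"
    and submodule_carrier: "x \<in> N \<Longrightarrow> x \<in> carrier M"
    and submodule_zero: "\<zero>\<^bsub>M\<^esub> \<in> N"
    and submodule_add: "\<lbrakk>x \<in> N; y \<in> N\<rbrakk> \<Longrightarrow> x \<oplus>\<^bsub>M\<^esub> y \<in> N"
    and submodule_smult: "\<lbrakk>r \<in> carrier R; x \<in> N\<rbrakk> \<Longrightarrow> r \<odot>\<^bsub>M\<^esub> x \<in> N"
    and submodule_neg: "x \<in> N \<Longrightarrow> \<ominus>\<^bsub>M\<^esub> x \<in> N"
    and submodule_minus: "\<lbrakk>x \<in> N; y \<in> N\<rbrakk> \<Longrightarrow> x \<ominus>\<^bsub>M\<^esub> y \<in> N"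
proof -
  interpret submodule N R M by fact
  show "N \<subseteq> carrier M" "x \<in> N \<Longrightarrow> x \<in> carrier M" "\<zero>\<^bsub>M\<^esub> \<in> N"
    "\<lbrakk>x \<in> N; y \<in> N\<rbrakk> \<Longrightarrow> x \<oplus>\<^bsub>M\<^esub> y \<in> N"
    "\<lbrakk>r \<in> carrier R; x \<in> N\<rbrakk> \<Longrightarrow> r \<odot>\<^bsub>M\<^esub> x \<in> N"
    using subset one_closed m_closed smult_closed by auto
  show neg: "x \<in> N \<Longrightarrow> \<ominus>\<^bsub>M\<^esub> x \<in> N" for x
    using m_inv_closed[of x] by (simp add: a_inv_def)
  show "\<lbrakk>x \<in> N; y \<in> N\<rbrakk> \<Longrightarrow> x \<ominus>\<^bsub>M\<^esub> y \<in> N"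
    using m_closed[of x "\<ominus>\<^bsub>M\<^esub> y"] neg by (auto simp: a_minus_def)
qed

lemma carrier_submodule: "submodule (carrier M) R M"
  by (rule submoduleI) auto

lemma zero_submodule: "submodule {\<zero>\<^bsub>M\<^esub>} R M"
  by (rule submoduleI) auto

lemma Int_submodule:
  assumes "submodule N R M" "submodule K R M"
  shows "submodule (N \<inter> K) R M"
  using assms submodule_subset[OF assms(1)]
  by (intro submoduleI) (auto intro: submodule_zero submodule_add submodule_smult)

lemma add_submodule:
  assumes N: "submodule N R M" and K: "submodule K R M"
  shows "submodule (N <+>\<^bsub>M\<^esub> K) R M"
proof (rule submoduleI)
  show "N <+>\<^bsub>M\<^esub> K \<subseteq> carrier M"
    using assms by (auto simp: set_add_def' dest: submodule_carrier)
  show "\<zero>\<^bsub>M\<^esub> \<in> N <+>\<^bsub>M\<^esub> K"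
    using submodule_zero[OF N] submodule_zero[OF K] by (force simp: set_add_def')
  fix x y assume "x \<in> N <+>\<^bsub>M\<^esub> K" "y \<in> N <+>\<^bsub>M\<^esub> K"
  then obtain a b c d where *: "a \<in> N" "b \<in> K" "c \<in> N" "d \<in> K"
    "x = a \<oplus>\<^bsub>M\<^esub> b" "y = c \<oplus>\<^bsub>M\<^esub> d"
    by (auto simp: set_add_def')
  then have "x \<oplus>\<^bsub>M\<^esub> y = (a \<oplus>\<^bsub>M\<^esub> c) \<oplus>\<^bsub>M\<^esub> (b \<oplus>\<^bsub>M\<^esub> d)"
    using submodule_carrier[OF N] submodule_carrier[OF K] by (simp add: M.a_ac)
  then show "x \<oplus>\<^bsub>M\<^esub> y \<in> N <+>\<^bsub>M\<^esub> K"
    using * submodule_add[OF N] submodule_add[OF K] by (force simp: set_add_def')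
next
  fix r x assume r: "r \<in> carrier R" "x \<in> N <+>\<^bsub>M\<^esub> K"
  then obtain a b where *: "a \<in> N" "b \<in> K" "x = a \<oplus>\<^bsub>M\<^esub> b"
    by (auto simp: set_add_def')
  then have "r \<odot>\<^bsub>M\<^esub> x = r \<odot>\<^bsub>M\<^esub> a \<oplus>\<^bsub>M\<^esub> r \<odot>\<^bsub>M\<^esub> b"
    using r submodule_carrier[OF N] submodule_carrier[OF K] by (simp add: smult_r_distr)
  then show "r \<odot>\<^bsub>M\<^esub> x \<in> N <+>\<^bsub>M\<^esub> K"
    using * r submodule_smult[OF N] submodule_smult[OF K] by (force simp: set_add_def')
qed

lemma subset_add_submodule:
  assumes N: "submodule N R M" and K: "submodule K R M"
  shows "N \<subseteq> N <+>\<^bsub>M\<^esub> K" "K \<subseteq> N <+>\<^bsub>M\<^esub> K"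
proof -
  show "N \<subseteq> N <+>\<^bsub>M\<^esub> K"
    using submodule_zero[OF K] submodule_carrier[OF N] by (force simp: set_add_def')
  show "K \<subseteq> N <+>\<^bsub>M\<^esub> K"
    using submodule_zero[OF N] submodule_carrier[OF K] by (force simp: set_add_def')
qed

lemma cyclic_submodule:
  assumes x: "x \<in> carrier M"
  shows "submodule ((\<lambda>r. r \<odot>\<^bsub>M\<^esub> x) ` carrier R) R M"
proof (rule submoduleI)
  show "\<zero>\<^bsub>M\<^esub> \<in> (\<lambda>r. r \<odot>\<^bsub>M\<^esub> x) ` carrier R"
    using x by (intro image_eqI[of _ _ "\<zero>\<^bsub>R\<^esub>"]) auto
next
  fix a b assume "a \<in> (\<lambda>r. r \<odot>\<^bsub>M\<^esub> x) ` carrier R" "b \<in> (\<lambda>r. r \<odot>\<^bsub>M\<^esub> x) ` carrier R"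
  then obtain r s where *: "r \<in> carrier R" "s \<in> carrier R" "a = r \<odot>\<^bsub>M\<^esub> x" "b = s \<odot>\<^bsub>M\<^esub> x"
    by auto
  then show "a \<oplus>\<^bsub>M\<^esub> b \<in> (\<lambda>r. r \<odot>\<^bsub>M\<^esub> x) ` carrier R"
    using x by (intro image_eqI[of _ _ "r \<oplus>\<^bsub>R\<^esub> s"]) (auto simp: smult_l_distr)
next
  fix s a assume s: "s \<in> carrier R" and "a \<in> (\<lambda>r. r \<odot>\<^bsub>M\<^esub> x) ` carrier R"
  then obtain r where *: "r \<in> carrier R" "a = r \<odot>\<^bsub>M\<^esub> x" by auto
  then show "s \<odot>\<^bsub>M\<^esub> a \<in> (\<lambda>r. r \<odot>\<^bsub>M\<^esub> x) ` carrier R"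
    using s x by (intro image_eqI[of _ _ "s \<otimes>\<^bsub>R\<^esub> r"]) (auto simp: smult_assoc)
qed (use x in auto)

lemma finsum_submodule:
  assumes N: "submodule N R M" and "finite F" "\<And>i. i \<in> F \<Longrightarrow> x i \<in> N"
  shows "finsum M x F \<in> N"
  using assms(2,3)
proof (induction F)
  case empty
  then show ?case using submodule_zero[OF N] by simp
next
  case (insert i F)
  then show ?case
    using submodule_carrier[OF N] submodule_add[OF N] by (subst M.finsum_insert) auto
qed

end

section \<open>Sums of families of submodules\<close>

lemma zero_mem_sum_submodules:
  assumes "left_module R M"
  shows "\<zero>\<^bsub>M\<^esub> \<in> sum_submodules M I N"
proof -
  interpret left_module R M by fact
  show ?thesis unfolding sum_submodules_def by (auto intro!: exI[of _ "{}"])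
qed

text \<open>A submodule is closed under finite sums, so containment can be tested on the summands.
  This spares all later work with \<open>module_prod\<close> and with direct sums from handling
  \<open>finsum\<close>.\<close>

lemma sum_submodules_subset_iff:
  assumes "left_module R M" and P: "submodule P R M" and I: "\<And>i. i \<in> I \<Longrightarrow> N i \<subseteq> carrier M"
  shows "sum_submodules M I N \<subseteq> P \<longleftrightarrow> (\<forall>i\<in>I. N i \<subseteq> P)"
proof -
  interpret left_module R M by fact
  show ?thesis
  proof
    assume L: "sum_submodules M I N \<subseteq> P"
    show "\<forall>i\<in>I. N i \<subseteq> P"
    proof (intro ballI subsetI)
      fix i a assume i: "i \<in> I" and a: "a \<in> N i"
      have "finsum M (\<lambda>_. a) {i} = a"
        using I[OF i] a by (subst M.finsum_insert) auto
      then have "a \<in> sum_submodules M I N"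
        unfolding sum_submodules_def using i a
        by (intro CollectI exI[of _ "\<lambda>_. a"] exI[of _ "{i}"]) auto
      then show "a \<in> P" using L by auto
    qed
  next
    assume "\<forall>i\<in>I. N i \<subseteq> P"
    then show "sum_submodules M I N \<subseteq> P"
      by (auto simp: sum_submodules_def subset_iff intro!: finsum_submodule[OF P])
  qed
qed

section \<open>Restriction to a submodule, and homomorphisms\<close>

lemma restrict_module_simps [simp]:
  "carrier (restrict_module M N) = N" "\<zero>\<^bsub>restrict_module M N\<^esub> = \<zero>\<^bsub>M\<^esub>"
  "x \<oplus>\<^bsub>restrict_module M N\<^esub> y = x \<oplus>\<^bsub>M\<^esub> y" "r \<odot>\<^bsub>restrict_module M N\<^esub> x = r \<odot>\<^bsub>M\<^esub> x"
  by (simp_all add: restrict_module_def)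

lemma left_module_restrict_module:
  assumes "left_module R M" "submodule N R M"
  shows "left_module R (restrict_module M N)"
proof -
  interpret M: left_module R M by fact
  have N: "\<And>x. x \<in> N \<Longrightarrow> x \<in> carrier M" using M.submodule_carrier[OF assms(2)] .
  show ?thesis
    by (rule left_moduleI)
      (auto simp: N M.submodule_zero[OF assms(2)] M.submodule_add[OF assms(2)]
        M.submodule_smult[OF assms(2)] M.smult_l_distr M.smult_r_distr M.smult_assoc M.R.ring_axioms
        M.M.a_ac)
qed


text \<open>Negation is defined through inverses within the carrier, so unfolding
  \<open>restrict_module\<close> does not settle this. Writing it in both modules as scaling by -1
  does.\<close>

lemma restrict_module_minus:
  assumes "left_module R M" "submodule N R M" "x \<in> N" "y \<in> N"
  shows "x \<ominus>\<^bsub>restrict_module M N\<^esub> y = x \<ominus>\<^bsub>M\<^esub> y"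
proof -
  interpret M: left_module R M by fact
  interpret N: left_module R "restrict_module M N"
    using assms(1,2) by (rule left_module_restrict_module)
  show ?thesis
    using assms(3,4) M.submodule_carrier[OF assms(2)]
    by (metis N.smult_minus_one M.smult_minus_one restrict_module_simps(1,3,4) a_minus_def)
qed

lemma HomI:
  assumes "\<And>x. x \<in> carrier A \<Longrightarrow> f x \<in> carrier B" "f \<in> extensional (carrier A)"
    and "\<And>x y. \<lbrakk>x \<in> carrier A; y \<in> carrier A\<rbrakk> \<Longrightarrow> f (x \<oplus>\<^bsub>A\<^esub> y) = f x \<oplus>\<^bsub>B\<^esub> f y"
    and "\<And>r x. \<lbrakk>r \<in> carrier R; x \<in> carrier A\<rbrakk> \<Longrightarrow> f (r \<odot>\<^bsub>A\<^esub> x) = r \<odot>\<^bsub>B\<^esub> f x"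
  shows "f \<in> Hom R A B"
  using assms by (auto simp: Hom_def PiE_def)

lemma
  assumes "f \<in> Hom R A B"
  shows Hom_closed: "x \<in> carrier A \<Longrightarrow> f x \<in> carrier B"
    and Hom_add: "\<lbrakk>x \<in> carrier A; y \<in> carrier A\<rbrakk> \<Longrightarrow> f (x \<oplus>\<^bsub>A\<^esub> y) = f x \<oplus>\<^bsub>B\<^esub> f y"
    and Hom_smult: "\<lbrakk>r \<in> carrier R; x \<in> carrier A\<rbrakk> \<Longrightarrow> f (r \<odot>\<^bsub>A\<^esub> x) = r \<odot>\<^bsub>B\<^esub> f x"
  using assms by (auto simp: Hom_def PiE_def)

lemma Hom_zero:
  assumes "left_module R A" "left_module R B" "f \<in> Hom R A B"
  shows "f \<zero>\<^bsub>A\<^esub> = \<zero>\<^bsub>B\<^esub>"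
proof -
  interpret A: left_module R A by fact
  interpret B: left_module R B by fact
  have "f (\<zero>\<^bsub>R\<^esub> \<odot>\<^bsub>A\<^esub> \<zero>\<^bsub>A\<^esub>) = \<zero>\<^bsub>R\<^esub> \<odot>\<^bsub>B\<^esub> f \<zero>\<^bsub>A\<^esub>"
    using Hom_smult[OF assms(3)] by blast
  then show ?thesis
    using Hom_closed[OF assms(3)] by simp
qed

lemma Hom_neg:
  assumes "left_module R A" "left_module R B" "f \<in> Hom R A B" "x \<in> carrier A"
  shows "f (\<ominus>\<^bsub>A\<^esub> x) = \<ominus>\<^bsub>B\<^esub> f x"
proof -
  interpret A: left_module R A by fact
  interpret B: left_module R B by fact
  show ?thesis
    using Hom_smult[OF assms(3), of "\<ominus>\<^bsub>R\<^esub> \<one>\<^bsub>R\<^esub>" x] assms(4) Hom_closed[OF assms(3)]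
    by (simp add: A.smult_minus_one B.smult_minus_one)
qed

lemma Hom_minus:
  assumes "left_module R A" "left_module R B" "f \<in> Hom R A B" "x \<in> carrier A" "y \<in> carrier A"
  shows "f (x \<ominus>\<^bsub>A\<^esub> y) = f x \<ominus>\<^bsub>B\<^esub> f y"
proof -
  interpret A: left_module R A by fact
  show ?thesis
    using assms Hom_neg[OF assms(1-3)] Hom_add[OF assms(3)] by (simp add: a_minus_def)
qed

lemma compose_Hom:
  assumes "left_module R A" "f \<in> Hom R B C" "g \<in> Hom R A B"
  shows "compose (carrier A) f g \<in> Hom R A C"
proof -
  interpret A: left_module R A by fact
  show ?thesis
    using Hom_closed[OF assms(2)] Hom_closed[OF assms(3)] 
    by (intro HomI) (auto simp: compose_eq Hom_add[OF assms(2)] Hom_add[OF assms(3)]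
        Hom_smult[OF assms(2)] Hom_smult[OF assms(3)])
qed

text \<open>By this equivalence maps M -> K are treated below as endomorphisms of M with image in K,
  which can be composed and iterated.\<close>

lemma Hom_restrict_module_iff:
  assumes "K \<subseteq> carrier M"
  shows "f \<in> Hom R A (restrict_module M K) \<longleftrightarrow> f \<in> Hom R A M \<and> f ` carrier A \<subseteq> K"
  using assms by (auto simp: Hom_def PiE_def Pi_def)

lemma restrict_Hom:
  assumes "left_module R M" "submodule N R M" "f \<in> Hom R M A"
  shows "restrict f N \<in> Hom R (restrict_module M N) A"
proof -
  interpret M: left_module R M by fact
  note [simp] = M.submodule_carrier[OF assms(2)] M.submodule_add[OF assms(2)]
    M.submodule_smult[OF assms(2)]
  show ?thesis
    using Hom_closed[OF assms(3)] Hom_add[OF assms(3)] Hom_smult[OF assms(3)]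
    by (intro HomI) auto
qed

lemma preimage_submodule:
  assumes "left_module R A" "left_module R B" "f \<in> Hom R A B" "submodule T R B"
  shows "submodule {x \<in> carrier A. f x \<in> T} R A"
proof -
  interpret A: left_module R A by fact
  interpret B: left_module R B by fact
  show ?thesis
    using B.submodule_zero[OF assms(4)] B.submodule_add[OF assms(4)] B.submodule_smult[OF assms(4)]
    by (intro A.submoduleI)
      (auto simp: Hom_zero[OF assms(1-3)] Hom_add[OF assms(3)] Hom_smult[OF assms(3)])
qed

lemma kernel_submodule:
  assumes "left_module R A" "left_module R B" "f \<in> Hom R A B"
  shows "submodule {x \<in> carrier A. f x = \<zero>\<^bsub>B\<^esub>} R A"
  using preimage_submodule[OF assms left_module.zero_submodule[OF assms(2)]] by simp

lemma image_submodule: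
  assumes "left_module R A" "left_module R B" "f \<in> Hom R A B" "submodule N R A"
  shows "submodule (f ` N) R B"
proof -
  interpret A: left_module R A by fact
  interpret B: left_module R B by fact
  note [simp] = A.submodule_carrier[OF assms(4)] Hom_closed[OF assms(3)]
  show ?thesis
  proof (rule B.submoduleI)
    show "\<zero>\<^bsub>B\<^esub> \<in> f ` N"
      using A.submodule_zero[OF assms(4)] Hom_zero[OF assms(1-3)] by force
  next
    fix x y assume "x \<in> f ` N" "y \<in> f ` N"
    then obtain a b where "a \<in> N" "b \<in> N" "x = f a" "y = f b" by auto
    then show "x \<oplus>\<^bsub>B\<^esub> y \<in> f ` N"
      using A.submodule_add[OF assms(4)]
      by (intro image_eqI[of _ _ "a \<oplus>\<^bsub>A\<^esub> b"]) (auto simp: Hom_add[OF assms(3)])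
  next
    fix r x assume "r \<in> carrier R" "x \<in> f ` N"
    then obtain a where "r \<in> carrier R" "a \<in> N" "x = f a" by auto
    then show "r \<odot>\<^bsub>B\<^esub> x \<in> f ` N"
      using A.submodule_smult[OF assms(4)]
      by (intro image_eqI[of _ _ "r \<odot>\<^bsub>A\<^esub> a"]) (auto simp: Hom_smult[OF assms(3)])
  qed auto
qed

section \<open>Image modules and membership in \<open>\<sigma>[M]\<close>\<close>

text \<open>Both quotients and isomorphic copies are image modules. They realise the subquotients of \<open>M\<close> on
  the type \<open>(nat \<Rightarrow> 'm) set\<close> to which projectivity and co-semisimplicity refer.\<close>

definition image_module :: "('a \<Rightarrow> 'u) \<Rightarrow> ('r, 'a) module \<Rightarrow> ('r, 'u) module"
  where "image_module e A =
    \<lparr>carrier = e ` carrier A, mult = undefined, one = undefined, zero = e \<zero>\<^bsub>A\<^esub>,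
     add = (\<lambda>a b. e (inv_into (carrier A) e a \<oplus>\<^bsub>A\<^esub> inv_into (carrier A) e b)),
     smult = (\<lambda>r a. e (r \<odot>\<^bsub>A\<^esub> inv_into (carrier A) e a))\<rparr>"

lemma image_module_simps [simp]:
  "carrier (image_module e A) = e ` carrier A" "\<zero>\<^bsub>image_module e A\<^esub> = e \<zero>\<^bsub>A\<^esub>"
  by (simp_all add: image_module_def)

text \<open>The fibres of \<open>e\<close> are the cosets of \<open>U\<close>, so
  \<open>image_module e A\<close> is a copy of A/U whose elements are arbitrary codes of type
  \<open>'u\<close>. An injective \<open>e\<close> is the case of zero \<open>U\<close>.\<close>

locale module_congruence = left_module R A for R :: "('r, 'x) ring_scheme" and A :: "('r, 'a) module" +
  fixes e :: "'a \<Rightarrow> 'u" and U :: "'a set"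
  assumes U: "submodule U R A"
    and eq_iff: "\<And>x y. \<lbrakk>x \<in> carrier A; y \<in> carrier A\<rbrakk> \<Longrightarrow> e x = e y \<longleftrightarrow> x \<ominus>\<^bsub>A\<^esub> y \<in> U"
begin

lemma inv_into_diff:
  assumes "x \<in> carrier A"
  shows "inv_into (carrier A) e (e x) \<in> carrier A" "inv_into (carrier A) e (e x) \<ominus>\<^bsub>A\<^esub> x \<in> U"
proof -
  show *: "inv_into (carrier A) e (e x) \<in> carrier A"
    using assms by (simp add: inv_into_into)
  show "inv_into (carrier A) e (e x) \<ominus>\<^bsub>A\<^esub> x \<in> U"
    using assms by (simp add: eq_iff[OF *, symmetric] f_inv_into_f)
qed

text \<open>The representatives picked by \<open>inv_into\<close> differ from x and y by elements of
  \<open>U\<close>, hence so do the two sums. This is the usual well-definedness of addition of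
  cosets.\<close>

lemma image_module_add:
  assumes "x \<in> carrier A" "y \<in> carrier A"
  shows "e x \<oplus>\<^bsub>image_module e A\<^esub> e y = e (x \<oplus>\<^bsub>A\<^esub> y)"
proof -
  let ?x = "inv_into (carrier A) e (e x)" and ?y = "inv_into (carrier A) e (e y)"
  have "(?x \<oplus>\<^bsub>A\<^esub> ?y) \<ominus>\<^bsub>A\<^esub> (x \<oplus>\<^bsub>A\<^esub> y) = (?x \<ominus>\<^bsub>A\<^esub> x) \<oplus>\<^bsub>A\<^esub> (?y \<ominus>\<^bsub>A\<^esub> y)"
    using assms inv_into_diff(1) by (simp add: a_minus_def M.minus_add M.a_ac)
  then have "(?x \<oplus>\<^bsub>A\<^esub> ?y) \<ominus>\<^bsub>A\<^esub> (x \<oplus>\<^bsub>A\<^esub> y) \<in> U"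
    using submodule_add[OF U] inv_into_diff(2) assms by simp
  then show ?thesis
    using assms inv_into_diff(1) by (simp add: image_module_def eq_iff)
qed

lemma image_module_smult:
  assumes "r \<in> carrier R" "x \<in> carrier A"
  shows "r \<odot>\<^bsub>image_module e A\<^esub> e x = e (r \<odot>\<^bsub>A\<^esub> x)"
proof -
  let ?x = "inv_into (carrier A) e (e x)"
  have "r \<odot>\<^bsub>A\<^esub> (?x \<ominus>\<^bsub>A\<^esub> x) = r \<odot>\<^bsub>A\<^esub> ?x \<oplus>\<^bsub>A\<^esub> r \<odot>\<^bsub>A\<^esub> (\<ominus>\<^bsub>A\<^esub> x)"
    using assms inv_into_diff(1) by (simp add: a_minus_def smult_r_distr)
  moreover have "r \<odot>\<^bsub>A\<^esub> (\<ominus>\<^bsub>A\<^esub> x) = \<ominus>\<^bsub>A\<^esub> (r \<odot>\<^bsub>A\<^esub> x)"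
    using assms smult_r_distr[of r "\<ominus>\<^bsub>A\<^esub> x" x] 
    by (simp add: M.l_neg M.minus_equality)
  ultimately have "r \<odot>\<^bsub>A\<^esub> ?x \<ominus>\<^bsub>A\<^esub> r \<odot>\<^bsub>A\<^esub> x \<in> U"
    using submodule_smult[OF U] inv_into_diff(2) assms by (metis a_minus_def)
  then show ?thesis
    using assms inv_into_diff(1) by (simp add: image_module_def eq_iff)
qed

lemma left_module_image_module: "left_module R (image_module e A)"
  by (rule left_moduleI)
    (auto simp: image_module_add image_module_smult R.ring_axioms M.a_ac
      smult_l_distr smult_r_distr smult_assoc)

lemma image_module_Hom: "restrict e (carrier A) \<in> Hom R A (image_module e A)"
  by (rule HomI) (auto simp: image_module_add image_module_smult)

lemma eq_zero_iff:
  assumes "x \<in> carrier A" shows "e x = e \<zero>\<^bsub>A\<^esub> \<longleftrightarrow> x \<in> U"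
  using assms eq_iff[of x "\<zero>\<^bsub>A\<^esub>"] M.minus_equality[of "\<zero>\<^bsub>A\<^esub>" "\<zero>\<^bsub>A\<^esub>"]
  by (simp add: a_minus_def)

end

section \<open>Direct powers, quotients, and subquotients of M in \<sigma>[M]\<close>

lemma direct_power_simps [simp]:
  "carrier (direct_power I M) = {x \<in> I \<rightarrow>\<^sub>E carrier M. finite {i \<in> I. x i \<noteq> \<zero>\<^bsub>M\<^esub>}}"
  "\<zero>\<^bsub>direct_power I M\<^esub> = (\<lambda>i\<in>I. \<zero>\<^bsub>M\<^esub>)"
  "x \<oplus>\<^bsub>direct_power I M\<^esub> y = (\<lambda>i\<in>I. x i \<oplus>\<^bsub>M\<^esub> y i)"
  "r \<odot>\<^bsub>direct_power I M\<^esub> x = (\<lambda>i\<in>I. r \<odot>\<^bsub>M\<^esub> x i)"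
  by (simp_all add: direct_power_def)

lemma left_module_direct_power:
  assumes "left_module R M"
  shows "left_module R (direct_power I M)"
proof -
  interpret left_module R M by fact
  have PiE: "x i \<in> carrier M" if "x \<in> I \<rightarrow>\<^sub>E carrier M" "i \<in> I" for x i
    using that by auto
  show ?thesis
  proof (rule left_moduleI)
    fix x y assume "x \<in> carrier (direct_power I M)" "y \<in> carrier (direct_power I M)"
    then have xy: "x \<in> I \<rightarrow>\<^sub>E carrier M" "y \<in> I \<rightarrow>\<^sub>E carrier M"
      and fin: "finite ({i \<in> I. x i \<noteq> \<zero>\<^bsub>M\<^esub>} \<union> {i \<in> I. y i \<noteq> \<zero>\<^bsub>M\<^esub>})" by auto
    have "finite {i \<in> I. x i \<oplus>\<^bsub>M\<^esub> y i \<noteq> \<zero>\<^bsub>M\<^esub>}"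
      by (rule finite_subset[OF _ fin]) auto
    then have "finite {i \<in> I. (\<lambda>i\<in>I. x i \<oplus>\<^bsub>M\<^esub> y i) i \<noteq> \<zero>\<^bsub>M\<^esub>}"
      by (rule rev_finite_subset) auto
    then show "x \<oplus>\<^bsub>direct_power I M\<^esub> y \<in> carrier (direct_power I M)"
      using xy PiE by (simp add: restrict_PiE_iff)
  next
    fix r x assume r: "r \<in> carrier R" and "x \<in> carrier (direct_power I M)"
    then have x: "x \<in> I \<rightarrow>\<^sub>E carrier M" and fin: "finite {i \<in> I. x i \<noteq> \<zero>\<^bsub>M\<^esub>}" by auto
    have "finite {i \<in> I. (\<lambda>i\<in>I. r \<odot>\<^bsub>M\<^esub> x i) i \<noteq> \<zero>\<^bsub>M\<^esub>}"
      by (rule finite_subset[OF _ fin]) (use r in auto)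
    then show "r \<odot>\<^bsub>direct_power I M\<^esub> x \<in> carrier (direct_power I M)"
      using x r PiE by (simp add: restrict_PiE_iff)
  next
    show "\<zero>\<^bsub>direct_power I M\<^esub> \<in> carrier (direct_power I M)"
      by (auto simp: restrict_PiE_iff)
  next
    fix x y z assume "x \<in> carrier (direct_power I M)" "y \<in> carrier (direct_power I M)"
      "z \<in> carrier (direct_power I M)"
    then show "(x \<oplus>\<^bsub>direct_power I M\<^esub> y) \<oplus>\<^bsub>direct_power I M\<^esub> z =
        x \<oplus>\<^bsub>direct_power I M\<^esub> (y \<oplus>\<^bsub>direct_power I M\<^esub> z)"
      by (auto simp: fun_eq_iff PiE M.a_assoc)
  next
    fix x y assume "x \<in> carrier (direct_power I M)" "y \<in> carrier (direct_power I M)"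
    then show "x \<oplus>\<^bsub>direct_power I M\<^esub> y = y \<oplus>\<^bsub>direct_power I M\<^esub> x"
      by (auto simp: fun_eq_iff PiE M.a_comm)
  qed (auto simp: fun_eq_iff PiE smult_l_distr smult_r_distr smult_assoc PiE_def extensional_def
      R.ring_axioms)
qed

lemma quotient_module_simps [simp]:
  "carrier (quotient_module A K) = a_rcosets\<^bsub>A\<^esub> K" "\<zero>\<^bsub>quotient_module A K\<^esub> = K"
  "C \<oplus>\<^bsub>quotient_module A K\<^esub> D = C <+>\<^bsub>A\<^esub> D"
  "r \<odot>\<^bsub>quotient_module A K\<^esub> C = (\<Union>x\<in>C. K +>\<^bsub>A\<^esub> (r \<odot>\<^bsub>A\<^esub> x))"
  by (simp_all add: quotient_module_def)

lemma coset_Hom: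
  assumes "left_module R A" "submodule K R A"
  shows "(\<lambda>x\<in>carrier A. K +>\<^bsub>A\<^esub> x) \<in> Hom R A (quotient_module A K)"
proof -
  interpret left_module R A by fact
  have sub: "subgroup K (add_monoid A)"
    using assms(2) by (simp add: submodule_def)
  interpret K: abelian_subgroup K A
    by (intro abelian_subgroupI3 additive_subgroupI sub M.abelian_group_axioms)
  show ?thesis
  proof (rule HomI)
    fix r x assume r: "r \<in> carrier R" and x: "x \<in> carrier A"
    \<comment> \<open>Scalar multiplication of a coset is defined as a union over its elements; all
      members of that union turn out to be one coset.\<close>
    have eq: "K +>\<^bsub>A\<^esub> (r \<odot>\<^bsub>A\<^esub> y) = K +>\<^bsub>A\<^esub> (r \<odot>\<^bsub>A\<^esub> x)" if y: "y \<in> K +>\<^bsub>A\<^esub> x" for y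
    proof -
      obtain k where k: "k \<in> K" "y = k \<oplus>\<^bsub>A\<^esub> x"
        using y by (auto simp: a_r_coset_def')
      have "r \<odot>\<^bsub>A\<^esub> y = r \<odot>\<^bsub>A\<^esub> k \<oplus>\<^bsub>A\<^esub> r \<odot>\<^bsub>A\<^esub> x"
        using k r x submodule_carrier[OF assms(2)] by (simp add: smult_r_distr)
      then have "r \<odot>\<^bsub>A\<^esub> y \<in> K +>\<^bsub>A\<^esub> (r \<odot>\<^bsub>A\<^esub> x)"
        using submodule_smult[OF assms(2) r k(1)] by (auto simp: a_r_coset_def')
      then show ?thesis
        using M.a_repr_independence[OF _ _ sub] r x by simp
    qed
    have "x \<in> K +>\<^bsub>A\<^esub> x" using x by (rule K.a_rcos_self)
    then have "(\<Union>y\<in>K +>\<^bsub>A\<^esub> x. K +>\<^bsub>A\<^esub> (r \<odot>\<^bsub>A\<^esub> y)) = K +>\<^bsub>A\<^esub> (r \<odot>\<^bsub>A\<^esub> x)"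
      using eq by blast
    then show "(\<lambda>x\<in>carrier A. K +>\<^bsub>A\<^esub> x) (r \<odot>\<^bsub>A\<^esub> x) =
      r \<odot>\<^bsub>quotient_module A K\<^esub> (\<lambda>x\<in>carrier A. K +>\<^bsub>A\<^esub> x) x"
      using r x by simp
  qed (auto simp: K.a_rcos_sum intro!: M.a_rcosetsI dest: submodule_carrier[OF assms(2)])
qed

lemma coset_eq_iff:
  assumes "left_module R A" "submodule K R A" "x \<in> carrier A" "y \<in> carrier A"
  shows "K +>\<^bsub>A\<^esub> x = K +>\<^bsub>A\<^esub> y \<longleftrightarrow> x \<ominus>\<^bsub>A\<^esub> y \<in> K"
proof -
  interpret left_module R A by fact
  have sub: "subgroup K (add_monoid A)"
    using assms(2) by (simp add: submodule_def)
  note KA = submodule_subset[OF assms(2)]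
  show ?thesis
  proof
    assume "K +>\<^bsub>A\<^esub> x = K +>\<^bsub>A\<^esub> y"
    then have "K +>\<^bsub>A\<^esub> (x \<ominus>\<^bsub>A\<^esub> y) = K"
      unfolding a_minus_def using assms(3,4) KA by (rule M.a_coset_add_inv2)
    then show "x \<ominus>\<^bsub>A\<^esub> y \<in> K"
      using assms(3,4) by (intro M.a_coset_join1[OF _ _ sub]) auto
  next
    assume "x \<ominus>\<^bsub>A\<^esub> y \<in> K"
    then have "K +>\<^bsub>A\<^esub> (x \<ominus>\<^bsub>A\<^esub> y) = K"
      using assms(3,4) by (intro M.a_coset_join2[OF _ sub]) auto
    then show "K +>\<^bsub>A\<^esub> x = K +>\<^bsub>A\<^esub> y"
      unfolding a_minus_def using assms(3,4) KA by (rule M.a_coset_add_inv1)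
  qed
qed

text \<open>The composite of N -> M -> M/U has the same fibres on N as \<open>e\<close>, so it
  induces an injection of the coded copy of N/U into M/U. One copy of M is thus enough, seen as a
  direct power with a single index.\<close>

lemma in_sigma_image_module:
  fixes M :: "('r, 'm) module" and e :: "'m \<Rightarrow> 'u"
  assumes "left_module R M" "submodule N R M" "module_congruence R (restrict_module M N) e U"
  shows "in_sigma R M (image_module e (restrict_module M N))"
proof -
  interpret M: left_module R M by fact
  interpret N: module_congruence R "restrict_module M N" e U by fact
  let ?A = "image_module e (restrict_module M N)"
  \<comment> \<open>The index \<open>undefined\<close> is just some element of the prescribed index
    type.\<close>
  define I :: "('u \<times> nat) set" where "I = {undefined}"
  define P where "P = direct_power I M"
  define c where "c = (\<lambda>x\<in>carrier M. \<lambda>i\<in>I. x)"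
  interpret P: left_module R P
    unfolding P_def using assms(1) by (rule left_module_direct_power)
  have c: "c \<in> Hom R M P"
    by (rule HomI) (auto simp: c_def P_def I_def fun_eq_iff)
  have inj_c: "inj_on c (carrier M)"
  proof (rule inj_onI)
    fix x y assume xy: "x \<in> carrier M" "y \<in> carrier M" and eq: "c x = c y"
    show "x = y" using xy fun_cong[OF eq, of undefined] by (simp add: c_def I_def)
  qed
  have NM: "x \<in> carrier M" if "x \<in> N" for x
    using that assms(2) by (rule M.submodule_carrier[rotated])
  note minus = restrict_module_minus[OF assms(1,2)]
  have U_subset: "U \<subseteq> N" using N.submodule_subset[OF N.U] by simp
  have U: "submodule U R M"
    using U_subset NM N.submodule_zero[OF N.U] N.submodule_add[OF N.U] N.submodule_smult[OF N.U]
    by (intro M.submoduleI) auto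
  define K where "K = c ` U"
  have K: "submodule K R P"
    unfolding K_def using image_submodule[OF assms(1) P.left_module_axioms c U] .
  define q where "q = (\<lambda>x\<in>carrier P. K +>\<^bsub>P\<^esub> x)"
  have q: "q \<in> Hom R P (quotient_module P K)"
    unfolding q_def by (rule coset_Hom[OF P.left_module_axioms K])
  define d where "d = compose (carrier M) q c"
  have d: "d \<in> Hom R M (quotient_module P K)"
    unfolding d_def by (rule compose_Hom[OF assms(1) q c])
  \<comment> \<open>Read from right to left this makes \<open>f\<close> below independent of
    representatives; read from left to right it makes \<open>f\<close> injective.\<close>
  have d_eq_iff: "d x = d y \<longleftrightarrow> e x = e y" if xy: "x \<in> N" "y \<in> N" for x y
  proof -
    have "d x = d y \<longleftrightarrow> c x \<ominus>\<^bsub>P\<^esub> c y \<in> K"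
      using NM xy Hom_closed[OF c] coset_eq_iff[OF P.left_module_axioms K, of "c x" "c y"]
      by (simp add: d_def q_def compose_eq)
    also have "c x \<ominus>\<^bsub>P\<^esub> c y = c (x \<ominus>\<^bsub>M\<^esub> y)"
      using Hom_minus[OF assms(1) P.left_module_axioms c] NM xy by simp
    also have "\<dots> \<in> K \<longleftrightarrow> x \<ominus>\<^bsub>M\<^esub> y \<in> U"
      using inj_on_image_mem_iff[OF inj_c, of "x \<ominus>\<^bsub>M\<^esub> y" U] NM xy U_subset
      by (auto simp: K_def)
    finally show ?thesis
      using xy by (simp add: N.eq_iff minus)
  qed
  define f where "f = (\<lambda>a\<in>carrier ?A. d (inv_into N e a))"
  have f: "f (e x) = d x" if "x \<in> N" for x
    using that by (simp add: f_def d_eq_iff inv_into_into f_inv_into_f)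
  have "f \<in> Hom R ?A (quotient_module P K)"
  proof (rule HomI)
    fix a b assume "a \<in> carrier ?A" "b \<in> carrier ?A"
    then obtain x y where "x \<in> N" "y \<in> N" "a = e x" "b = e y" by auto
    then show "f (a \<oplus>\<^bsub>?A\<^esub> b) = f a \<oplus>\<^bsub>quotient_module P K\<^esub> f b"
      using Hom_add[OF d] NM M.submodule_add[OF assms(2)]
      by (simp add: N.image_module_add f)
  next
    fix r a assume "r \<in> carrier R" "a \<in> carrier ?A"
    then obtain x where "r \<in> carrier R" "x \<in> N" "a = e x" by auto
    then show "f (r \<odot>\<^bsub>?A\<^esub> a) = r \<odot>\<^bsub>quotient_module P K\<^esub> f a"
      using Hom_smult[OF d] NM M.submodule_smult[OF assms(2)]
      by (simp add: N.image_module_smult f)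
  next
    fix a assume "a \<in> carrier ?A"
    then show "f a \<in> carrier (quotient_module P K)"
      using Hom_closed[OF d] NM by (auto simp: f simp del: quotient_module_simps)
  qed (simp add: f_def)
  moreover have "inj_on f (carrier ?A)"
    by (auto intro!: inj_onI simp: f d_eq_iff)
  ultimately show ?thesis
    using K N.left_module_image_module unfolding in_sigma_def P_def by blast
qed

lemma (in left_module) minus_eq_zero_iff:
  assumes "x \<in> carrier M" "y \<in> carrier M"
  shows "x \<ominus>\<^bsub>M\<^esub> y = \<zero>\<^bsub>M\<^esub> \<longleftrightarrow> x = y"
proof
  assume "x \<ominus>\<^bsub>M\<^esub> y = \<zero>\<^bsub>M\<^esub>"
  then show "x = y"
    using assms M.minus_equality[of x "\<ominus>\<^bsub>M\<^esub> y"] by (simp add: a_minus_def M.minus_minus)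
qed (use assms in \<open>simp add: a_minus_def M.r_neg\<close>)

lemma module_congruence_fibre:
  assumes "left_module R A" "left_module R C" "g \<in> Hom R A C"
    and "\<And>x y. \<lbrakk>x \<in> carrier A; y \<in> carrier A\<rbrakk> \<Longrightarrow> e x = e y \<longleftrightarrow> g x = g y"
  shows "module_congruence R A e {x \<in> carrier A. g x = \<zero>\<^bsub>C\<^esub>}"
proof -
  interpret A: left_module R A by fact
  interpret C: left_module R C by fact
  show ?thesis
  proof (intro module_congruence.intro module_congruence_axioms.intro A.left_module_axioms)
    show "submodule {x \<in> carrier A. g x = \<zero>\<^bsub>C\<^esub>} R A"
      by (rule kernel_submodule[OF assms(1-3)])
    fix x y assume "x \<in> carrier A" "y \<in> carrier A"
    then show "e x = e y \<longleftrightarrow> x \<ominus>\<^bsub>A\<^esub> y \<in> {x \<in> carrier A. g x = \<zero>\<^bsub>C\<^esub>}"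
      by (simp add: assms(4) Hom_minus[OF assms(1-3)] C.minus_eq_zero_iff Hom_closed[OF assms(3)])
  qed
qed

lemma module_congruence_inj:
  assumes "left_module R A" "inj_on e (carrier A)"
  shows "module_congruence R A e {\<zero>\<^bsub>A\<^esub>}"
proof -
  interpret A: left_module R A by fact
  show ?thesis
  proof (intro module_congruence.intro module_congruence_axioms.intro A.left_module_axioms)
    show "submodule {\<zero>\<^bsub>A\<^esub>} R A" by (rule A.zero_submodule)
    fix x y assume "x \<in> carrier A" "y \<in> carrier A"
    then show "e x = e y \<longleftrightarrow> x \<ominus>\<^bsub>A\<^esub> y \<in> {\<zero>\<^bsub>A\<^esub>}"
      by (simp add: inj_on_eq_iff[OF assms(2)] A.minus_eq_zero_iff)
  qed
qed

lemma submodule_restrict_module_iff: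
  assumes "left_module R M" "submodule N R M"
  shows "submodule W R (restrict_module M N) \<longleftrightarrow> submodule W R M \<and> W \<subseteq> N"
proof -
  interpret M: left_module R M by fact
  interpret N: left_module R "restrict_module M N"
    using assms by (rule left_module_restrict_module)
  show ?thesis
  proof
    assume W: "submodule W R (restrict_module M N)"
    have "W \<subseteq> N" using N.submodule_subset[OF W] by simp
    moreover have "W \<subseteq> carrier M" using calculation M.submodule_subset[OF assms(2)] by simp
    ultimately show "submodule W R M \<and> W \<subseteq> N"
      using N.submodule_zero[OF W] N.submodule_add[OF W] N.submodule_smult[OF W]
      by (auto intro!: M.submoduleI)
  next
    assume "submodule W R M \<and> W \<subseteq> N"
    then show "submodule W R (restrict_module M N)"
      using M.submodule_zero[of W] M.submodule_add[of W] M.submodule_smult[of W]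
      by (auto intro!: N.submoduleI)
  qed
qed

text \<open>The image of N is a nonzero submodule of S. Being onto, \<open>g\<close> on N satisfies
  the range condition of \<open>lift_Hom\<close> for every map M -> S.\<close>

lemma simple_module_surj:
  assumes "left_module R M" "simple_module R S" "g \<in> Hom R M S" "submodule N R M"
    "x \<in> N" "g x \<noteq> \<zero>\<^bsub>S\<^esub>"
  shows "g ` N = carrier S"
  using image_submodule[OF assms(1) _ assms(3,4)] assms(2,5,6) unfolding simple_module_def
  by blast

section \<open>Projectivity and co-semisimplicity\<close>

locale projective_module = left_module R M for R :: "('r, 'x) ring_scheme" and M :: "('r, 'm) module" +
  assumes projective: "projective_in_sigma TYPE((nat \<Rightarrow> 'm) set) R M"
begin

text \<open>Projectivity is applied to 0 -> K -> N -> N/K -> 0, where K is the kernel of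
  \<open>g\<close>. Since it speaks only of modules on \<open>(nat \<Rightarrow> 'm) set\<close>,
  all three terms are first coded on that type. The target C enters only through g(N), which is
  isomorphic to N/K, so it may live on any type.\<close>

lemma lift_Hom:
  fixes C :: "('r, 'c) module"
  assumes N: "submodule N R M" and C: "left_module R C"
    and g: "g \<in> Hom R (restrict_module M N) C" and h: "h \<in> Hom R M C"
    and hg: "h ` carrier M \<subseteq> g ` N"
  obtains \<psi> where "\<psi> \<in> Hom R M M" "\<psi> ` carrier M \<subseteq> N" "\<And>x. x \<in> carrier M \<Longrightarrow> g (\<psi> x) = h x"
proof -
  let ?N = "restrict_module M N"
  interpret C: left_module R C by fact
  interpret N: left_module R ?N
    using left_module_axioms N by (rule left_module_restrict_module)
  note NM = submodule_carrier[OF N]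
  define K where "K = {x \<in> N. g x = \<zero>\<^bsub>C\<^esub>}"
  have "submodule K R ?N"
    unfolding K_def using kernel_submodule[OF N.left_module_axioms C g] by simp
  then have K: "submodule K R M"
    by (simp add: submodule_restrict_module_iff[OF left_module_axioms N])
  \<comment> \<open>Elements of M become constant sequences. \<open>s\<close> codes an element by a
    singleton, hence injectively, while \<open>e\<close> codes it by its whole fibre under
    \<open>g\<close>, hence as an element of N/K.\<close>
  define s :: "'m \<Rightarrow> (nat \<Rightarrow> 'm) set" where "s = (\<lambda>x. {\<lambda>_. x})"
  define e :: "'m \<Rightarrow> (nat \<Rightarrow> 'm) set" where "e = (\<lambda>x. (\<lambda>y _. y) ` {y \<in> N. g y = g x})"
  have inj_s: "inj_on s X" for X
    by (auto simp: s_def inj_on_def fun_eq_iff)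
  have e_eq_iff: "e x = e y \<longleftrightarrow> g x = g y" if "x \<in> N" "y \<in> N" for x y
  proof
    assume "e x = e y"
    moreover have "(\<lambda>_. x) \<in> e x" using that by (auto simp: e_def)
    ultimately have "(\<lambda>_. x) \<in> e y" by simp
    then show "g x = g y" by (auto simp: e_def fun_eq_iff)
  qed (simp add: e_def)
  interpret A: module_congruence R "restrict_module M K" s "{\<zero>\<^bsub>M\<^esub>}"
    using module_congruence_inj[OF left_module_restrict_module[OF left_module_axioms K] inj_s]
    by simp
  interpret B: module_congruence R ?N s "{\<zero>\<^bsub>M\<^esub>}"
    using module_congruence_inj[OF N.left_module_axioms inj_s] by simp
  interpret E: module_congruence R ?N e K
    using module_congruence_fibre[OF N.left_module_axioms C g, of e] e_eq_iff
    by (simp add: K_def)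
  let ?A = "image_module s (restrict_module M K)"
  let ?B = "image_module s ?N" and ?E = "image_module e ?N"
  have in_sigma: "in_sigma R M ?A" "in_sigma R M ?B" "in_sigma R M ?E"
    using in_sigma_image_module[OF left_module_axioms] K N
      A.module_congruence_axioms B.module_congruence_axioms E.module_congruence_axioms by blast+
  define f' where "f' = (\<lambda>a\<in>carrier ?A. a)"
  have KN: "K \<subseteq> N" by (auto simp: K_def)
  have f': "f' \<in> Hom R ?A ?B"
  proof (rule HomI)
    fix a b assume "a \<in> carrier ?A" "b \<in> carrier ?A"
    then obtain x y where "x \<in> K" "y \<in> K" "a = s x" "b = s y" by auto
    then show "f' (a \<oplus>\<^bsub>?A\<^esub> b) = f' a \<oplus>\<^bsub>?B\<^esub> f' b"
      using A.image_module_add B.image_module_add KN submodule_add[OF K]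
      by (simp add: f'_def subset_iff)
  next
    fix r a assume "r \<in> carrier R" "a \<in> carrier ?A"
    then obtain x where "r \<in> carrier R" "x \<in> K" "a = s x" by auto
    then show "f' (r \<odot>\<^bsub>?A\<^esub> a) = r \<odot>\<^bsub>?B\<^esub> f' a"
      using A.image_module_smult B.image_module_smult KN submodule_smult[OF K]
      by (simp add: f'_def subset_iff)
  qed (use KN in \<open>auto simp: f'_def\<close>)
  \<comment> \<open>\<open>u\<close> undoes the coding \<open>s\<close>; it will turn the lift M ->
    \<open>?B\<close> into a map from M to N itself.\<close>
  define u where "u = (\<lambda>b\<in>carrier ?B. inv_into N s b)"
  have us: "u (s x) = x" if "x \<in> N" for x
    using that by (simp add: u_def inj_s)
  have u: "u \<in> Hom R ?B ?N"
  proof (rule HomI)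
    fix a b assume "a \<in> carrier ?B" "b \<in> carrier ?B"
    then obtain x y where "x \<in> N" "y \<in> N" "a = s x" "b = s y" by auto
    then show "u (a \<oplus>\<^bsub>?B\<^esub> b) = u a \<oplus>\<^bsub>?N\<^esub> u b"
      using B.image_module_add submodule_add[OF N] by (simp add: us)
  next
    fix r a assume "r \<in> carrier R" "a \<in> carrier ?B"
    then obtain x where "r \<in> carrier R" "x \<in> N" "a = s x" by auto
    then show "u (r \<odot>\<^bsub>?B\<^esub> a) = r \<odot>\<^bsub>?N\<^esub> u a"
      using B.image_module_smult submodule_smult[OF N] by (simp add: us)
  qed (auto simp: us, auto simp: u_def)
  define g' where "g' = compose (carrier ?B) (restrict e N) u"
  have g': "g' \<in> Hom R ?B ?E"
    unfolding g'_def
    using compose_Hom[OF B.left_module_image_module _ u] E.image_module_Hom by simp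
  have g's: "g' (s x) = e x" if "x \<in> N" for x
    using that by (simp add: g'_def compose_eq us)
  have "short_exact R ?A ?B ?E f' g'"
    unfolding short_exact_def
  proof (intro conjI f' g')
    show "inj_on f' (carrier ?A)" by (auto simp: f'_def inj_on_def)
    have "f' ` carrier ?A = s ` K" by (auto simp: f'_def)
    also have "\<dots> = {b \<in> carrier ?B. g' b = \<zero>\<^bsub>?E\<^esub>}"
    proof -
      have "g' (s x) = e \<zero>\<^bsub>M\<^esub> \<longleftrightarrow> x \<in> K" if "x \<in> N" for x
        using that E.eq_zero_iff by (simp add: g's)
      then have "K = {x \<in> N. g' (s x) = e \<zero>\<^bsub>M\<^esub>}" using KN by blast
      then show ?thesis by auto
    qed
    finally show "f' ` carrier ?A = a_kernel ?B ?E g'"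
      by (simp add: a_kernel_def kernel_def)
    show "g' ` carrier ?B = carrier ?E" by (auto simp: g's image_image)
  qed
  then have surj: "compose (carrier M) g' ` Hom R M ?B = Hom R M ?E"
    using projective in_sigma unfolding projective_in_sigma_def by blast
  \<comment> \<open>The choice \<open>p\<close> of preimages under \<open>g\<close> is in general
    not additive, but \<open>e\<close> sees only the values of \<open>g\<close>, so
    \<open>h'\<close> is a homomorphism.\<close>
  define p where "p = (\<lambda>x. inv_into N g (h x))"
  have p: "p x \<in> N" "g (p x) = h x" if "x \<in> carrier M" for x
    using that hg by (auto simp: p_def f_inv_into_f inv_into_into image_subset_iff)
  define h' where "h' = (\<lambda>x\<in>carrier M. e (p x))"
  have "h' \<in> Hom R M ?E"
  proof (rule HomI)
    fix x y assume xy: "x \<in> carrier M" "y \<in> carrier M"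
    then have "g (p (x \<oplus>\<^bsub>M\<^esub> y)) = g (p x \<oplus>\<^bsub>M\<^esub> p y)"
      using Hom_add[OF g] Hom_add[OF h] p by simp
    then have "e (p (x \<oplus>\<^bsub>M\<^esub> y)) = e (p x \<oplus>\<^bsub>M\<^esub> p y)"
      using e_eq_iff xy p submodule_add[OF N] by simp
    then show "h' (x \<oplus>\<^bsub>M\<^esub> y) = h' x \<oplus>\<^bsub>?E\<^esub> h' y"
      using xy p E.image_module_add by (simp add: h'_def)
  next
    fix r x assume xy: "r \<in> carrier R" "x \<in> carrier M"
    then have "g (p (r \<odot>\<^bsub>M\<^esub> x)) = g (r \<odot>\<^bsub>M\<^esub> p x)"
      using Hom_smult[OF g] Hom_smult[OF h] p by simp
    then have "e (p (r \<odot>\<^bsub>M\<^esub> x)) = e (r \<odot>\<^bsub>M\<^esub> p x)"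
      using e_eq_iff xy p submodule_smult[OF N] by simp
    then show "h' (r \<odot>\<^bsub>M\<^esub> x) = r \<odot>\<^bsub>?E\<^esub> h' x"
      using xy p E.image_module_smult by (simp add: h'_def)
  qed (use p in \<open>auto simp: h'_def\<close>)
  then obtain \<phi> where \<phi>: "\<phi> \<in> Hom R M ?B" and h'_eq: "h' = compose (carrier M) g' \<phi>"
    unfolding surj[symmetric] by (elim imageE)
  define \<psi> where "\<psi> = compose (carrier M) u \<phi>"
  have "\<psi> \<in> Hom R M ?N"
    unfolding \<psi>_def by (rule compose_Hom[OF left_module_axioms u \<phi>])
  then have \<psi>: "\<psi> \<in> Hom R M M" "\<psi> ` carrier M \<subseteq> N"
    unfolding Hom_restrict_module_iff[OF submodule_subset[OF N]] by simp_all
  moreover have "g (\<psi> x) = h x" if x: "x \<in> carrier M" for x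
  proof -
    obtain n where n: "n \<in> N" "\<phi> x = s n" using Hom_closed[OF \<phi> x] by auto
    then have "e n = e (p x)"
      using fun_cong[OF h'_eq, of x] x by (simp add: h'_def compose_eq g's)
    then show ?thesis
      using n p[OF x] e_eq_iff x by (simp add: \<psi>_def compose_eq us)
  qed
  ultimately show ?thesis using that by blast
qed

end

section \<open>Separation by injective simple modules\<close>

locale projective_co_semisimple = projective_module R M
  for R :: "('r, 'x) ring_scheme" and M :: "('r, 'm) module" +
  assumes co_semisimple: "co_semisimple TYPE((nat \<Rightarrow> 'm) set) R M"
begin

text \<open>\<open>S\<close> is \<open>(Rx + U)/U\<close>, where \<open>U\<close> is maximal among the submodules that contain \<open>T\<close> but not \<open>x\<close>.\<close>

lemma separating_Hom:
  assumes T: "submodule T R M" and x: "x \<in> carrier M" "x \<notin> T"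
  obtains S :: "('r, (nat \<Rightarrow> 'm) set) module" and g where
    "simple_module R S" "M_injective R M S" "g \<in> Hom R M S"
    "\<And>t. t \<in> T \<Longrightarrow> g t = \<zero>\<^bsub>S\<^esub>" "g x \<noteq> \<zero>\<^bsub>S\<^esub>"
proof -
  define \<A> where "\<A> = {U. submodule U R M \<and> T \<subseteq> U \<and> x \<notin> U}"
  have "\<exists>U\<in>\<A>. \<forall>X\<in>\<A>. U \<subseteq> X \<longrightarrow> X = U"
  proof (rule subset_Zorn_nonempty)
    show "\<A> \<noteq> {}" using T x by (auto simp: \<A>_def)
    fix \<C> assume ne: "\<C> \<noteq> {}" and chain: "subset.chain \<A> \<C>"
    then have sub: "submodule U R M" "T \<subseteq> U" "x \<notin> U" if "U \<in> \<C>" for U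
      using that by (auto simp: \<A>_def subset.chain_def)
    have "submodule (\<Union>\<C>) R M"
    proof (rule submoduleI)
      show "\<Union>\<C> \<subseteq> carrier M" using submodule_subset sub by blast
      show "\<zero>\<^bsub>M\<^esub> \<in> \<Union>\<C>" using submodule_zero sub ne by blast
      fix a b assume "a \<in> \<Union>\<C>" "b \<in> \<Union>\<C>"
      then obtain U V where UV: "U \<in> \<C>" "V \<in> \<C>" "a \<in> U" "b \<in> V" by auto
      have "U \<subseteq> V \<or> V \<subseteq> U" using chain UV by (auto simp: subset.chain_def)
      then show "a \<oplus>\<^bsub>M\<^esub> b \<in> \<Union>\<C>"
        using UV submodule_add[OF sub(1)] by blast
    next
      fix r a assume "r \<in> carrier R" "a \<in> \<Union>\<C>"
      then show "r \<odot>\<^bsub>M\<^esub> a \<in> \<Union>\<C>" using submodule_smult[OF sub(1)] by blast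
    qed
    then show "\<Union>\<C> \<in> \<A>" using sub ne unfolding \<A>_def by blast
  qed
  then obtain U where U: "submodule U R M" "T \<subseteq> U" "x \<notin> U"
    and max: "\<And>X. \<lbrakk>submodule X R M; U \<subseteq> X; x \<notin> X\<rbrakk> \<Longrightarrow> X = U"
    by (auto simp: \<A>_def)
  let ?Rx = "(\<lambda>r. r \<odot>\<^bsub>M\<^esub> x) ` carrier R"
  note Rx = cyclic_submodule[OF x(1)]
  define V where "V = ?Rx <+>\<^bsub>M\<^esub> U"
  have V: "submodule V R M" unfolding V_def by (rule add_submodule[OF Rx U(1)])
  have "x \<in> ?Rx" using x(1) by (intro image_eqI[of _ _ "\<one>\<^bsub>R\<^esub>"]) auto
  then have xV: "x \<in> V" and UV: "U \<subseteq> V"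
    using subset_add_submodule[OF Rx U(1)] by (auto simp: V_def)
  \<comment> \<open>\<open>V\<close> is the smallest submodule containing \<open>U\<close> and
    \<open>x\<close>; this and the maximality of \<open>U\<close> make V/U simple.\<close>
  have V_least: "V \<subseteq> W" if W: "submodule W R M" "U \<subseteq> W" "x \<in> W" for W
    using submodule_smult[OF W(1) _ W(3)] submodule_add[OF W(1)] W(2)
    unfolding V_def set_add_def' by blast
  let ?V = "restrict_module M V"
  interpret V: left_module R ?V
    using left_module_axioms V by (rule left_module_restrict_module)
  note minus = restrict_module_minus[OF left_module_axioms V]
  \<comment> \<open>An element of \<open>V\<close> is coded by its coset modulo \<open>U\<close>,
    again as a set of constant sequences.\<close>
  define e :: "'m \<Rightarrow> (nat \<Rightarrow> 'm) set"
    where "e = (\<lambda>v. (\<lambda>y _. y) ` {y \<in> V. y \<ominus>\<^bsub>M\<^esub> v \<in> U})"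
  \<comment> \<open>Given that a - b lies in \<open>U\<close>, these identities show that y - a lies
    in \<open>U\<close> exactly when y - b does.\<close>
  have diff: "a \<ominus>\<^bsub>M\<^esub> b = (a \<ominus>\<^bsub>M\<^esub> c) \<ominus>\<^bsub>M\<^esub> (b \<ominus>\<^bsub>M\<^esub> c)"
    "a \<ominus>\<^bsub>M\<^esub> b = (a \<ominus>\<^bsub>M\<^esub> c) \<oplus>\<^bsub>M\<^esub> (c \<ominus>\<^bsub>M\<^esub> b)"
    if "a \<in> carrier M" "b \<in> carrier M" "c \<in> carrier M" for a b c
  proof -
    show "a \<ominus>\<^bsub>M\<^esub> b = (a \<ominus>\<^bsub>M\<^esub> c) \<oplus>\<^bsub>M\<^esub> (c \<ominus>\<^bsub>M\<^esub> b)" 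
      using that by (simp add: a_minus_def M.a_assoc M.r_neg1)
    then show "a \<ominus>\<^bsub>M\<^esub> b = (a \<ominus>\<^bsub>M\<^esub> c) \<ominus>\<^bsub>M\<^esub> (b \<ominus>\<^bsub>M\<^esub> c)"
      using that by (simp add: a_minus_def M.minus_add M.minus_minus M.a_ac)
  qed
  have "module_congruence R ?V e U"
  proof (intro module_congruence.intro module_congruence_axioms.intro V.left_module_axioms)
    show "submodule U R ?V"
      using U UV by (simp add: submodule_restrict_module_iff[OF left_module_axioms V])
    fix a b assume "a \<in> carrier ?V" "b \<in> carrier ?V"
    then have ab: "a \<in> V" "b \<in> V" by auto
    then have abM: "a \<in> carrier M" "b \<in> carrier M" using submodule_carrier[OF V] by auto
    show "e a = e b \<longleftrightarrow> a \<ominus>\<^bsub>?V\<^esub> b \<in> U"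
    proof
      assume eq: "e a = e b"
      have "(\<lambda>_. a) \<in> e a"
        using ab abM submodule_zero[OF U(1)] by (auto simp: e_def minus_eq_zero_iff[THEN iffD2])
      then have "(\<lambda>_. a) \<in> e b" using eq by simp
      then show "a \<ominus>\<^bsub>?V\<^esub> b \<in> U" using ab by (auto simp: e_def fun_eq_iff minus)
    next
      assume "a \<ominus>\<^bsub>?V\<^esub> b \<in> U"
      then have *: "a \<ominus>\<^bsub>M\<^esub> b \<in> U" using ab by (simp add: minus)
      have "y \<ominus>\<^bsub>M\<^esub> a \<in> U \<longleftrightarrow> y \<ominus>\<^bsub>M\<^esub> b \<in> U" if "y \<in> V" for y
        using submodule_carrier[OF V that] abM diff(1)[of y a b] diff(2)[of y b a]
          submodule_add[OF U(1) _ *] submodule_minus[OF U(1) _ *] by metis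
      then show "e a = e b" by (auto simp: e_def)
    qed
  qed
  then interpret E: module_congruence R ?V e U .
  let ?S = "image_module e ?V"
  have sigma: "in_sigma R M ?S"
    by (rule in_sigma_image_module[OF left_module_axioms V E.module_congruence_axioms])
  have ex: "e x \<noteq> e \<zero>\<^bsub>M\<^esub>"
    using E.eq_zero_iff[of x] xV U(3) by simp
  interpret S: left_module R ?S by (rule E.left_module_image_module)
  have simple: "simple_module R ?S"
    unfolding simple_module_def
  proof (intro conjI allI impI)
    show "carrier ?S \<noteq> {\<zero>\<^bsub>?S\<^esub>}" using ex xV by auto
    fix N assume N: "submodule N R ?S"
    define W where "W = {v \<in> V. e v \<in> N}"
    have "submodule {v \<in> carrier ?V. restrict e (carrier ?V) v \<in> N} R ?V"
      by (rule preimage_submodule[OF V.left_module_axioms S.left_module_axioms E.image_module_Hom N])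
    also have "{v \<in> carrier ?V. restrict e (carrier ?V) v \<in> N} = W" by (auto simp: W_def)
    finally have W: "submodule W R M" 
      by (simp add: submodule_restrict_module_iff[OF left_module_axioms V])
    have NW: "N = e ` W" using S.submodule_subset[OF N] by (auto simp: W_def)
    have UW: "U \<subseteq> W"
    proof
      fix u assume u: "u \<in> U"
      then have "e u = e \<zero>\<^bsub>M\<^esub>" using E.eq_zero_iff[of u] UV by auto
      then show "u \<in> W" using u UV S.submodule_zero[OF N] by (auto simp: W_def)
    qed
    \<comment> \<open>The preimage \<open>W\<close> of N contains \<open>U\<close>. If it contains
      \<open>x\<close> it is all of \<open>V\<close>; otherwise maximality forces it to be
      \<open>U\<close>.\<close>
    show "N = {\<zero>\<^bsub>?S\<^esub>} \<or> N = carrier ?S"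
    proof (cases "x \<in> W")
      case True
      then have "V \<subseteq> W" by (rule V_least[OF W UW])
      then have "W = V" by (auto simp: W_def)
      then show ?thesis using NW by simp
    next
      case False
      then have "W = U" by (rule max[OF W UW])
      moreover have "e ` U = {e \<zero>\<^bsub>M\<^esub>}"
        using E.eq_zero_iff UV submodule_zero[OF U(1)] by auto
      ultimately show ?thesis using NW by simp
    qed
  qed (rule S.left_module_axioms)
  have inj: "M_injective R M ?S"
    using co_semisimple sigma simple unfolding co_semisimple_def by blast
  \<comment> \<open>The quotient map V -> V/U extends to M by injectivity. It kills
    \<open>T\<close>, which lies in \<open>U\<close>, but not \<open>x\<close>.\<close>
  obtain g where g: "g \<in> Hom R M ?S" "\<forall>v\<in>V. g v = restrict e V v"
    using inj V E.image_module_Hom[unfolded restrict_module_simps] unfolding M_injective_def by meson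
  show ?thesis
  proof (rule that[OF simple inj g(1)])
    show "g x \<noteq> \<zero>\<^bsub>?S\<^esub>" using g(2) xV ex by simp
    fix t assume "t \<in> T"
    then show "g t = \<zero>\<^bsub>?S\<^esub>" using g(2) E.eq_zero_iff[of t] U(2) UV by auto
  qed
qed

text \<open>Otherwise some g : M -> S with S simple kills \<open>T\<close> but not \<open>x\<close>.
  As \<open>x\<close> lies in N, already g(N) = S, so \<open>g\<close> lifts to f : M -> N with g f
  = g; now f(x) in \<open>T\<close> gives g(x) = g(f(x)) = 0. With \<open>T\<close> zero this is the
  main means below of showing that an element vanishes.\<close>

lemma mem_if_Hom_images_mem:
  assumes N: "submodule N R M" "x \<in> N" and T: "submodule T R M"
    and Hom: "\<And>f. \<lbrakk>f \<in> Hom R M M; f ` carrier M \<subseteq> N\<rbrakk> \<Longrightarrow> f x \<in> T"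
  shows "x \<in> T"
proof (rule ccontr)
  assume "x \<notin> T"
  have xM: "x \<in> carrier M" by (rule submodule_carrier[OF N])
  obtain S :: "('r, (nat \<Rightarrow> 'm) set) module" and g where
    S: "simple_module R S" and g: "g \<in> Hom R M S"
    and gT: "\<And>t. t \<in> T \<Longrightarrow> g t = \<zero>\<^bsub>S\<^esub>" and gx: "g x \<noteq> \<zero>\<^bsub>S\<^esub>"
    using separating_Hom[OF T xM \<open>x \<notin> T\<close>] by metis
  have "left_module R S" using S by (simp add: simple_module_def)
  moreover have "g ` carrier M \<subseteq> restrict g N ` N"
    using simple_module_surj[OF left_module_axioms S g N gx] Hom_closed[OF g] by auto
  ultimately obtain f where f: "f \<in> Hom R M M" "f ` carrier M \<subseteq> N"
    "\<And>y. y \<in> carrier M \<Longrightarrow> restrict g N (f y) = g y"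
    using lift_Hom[OF N(1) _ restrict_Hom[OF left_module_axioms N(1) g] g] by metis
  then show False
    using gT[OF Hom[OF f(1,2)]] gx xM by force
qed

lemma fully_invariant_eq_carrier:
  assumes I: "fully_invariant R M I"
    and f: "f \<in> Hom R M M" "inj_on f (carrier M)" "f ` carrier M \<subseteq> I"
  shows "I = carrier M"
proof (rule ccontr)
  have I': "submodule I R M" using I by (simp add: fully_invariant_def)
  assume "I \<noteq> carrier M"
  then obtain x where x: "x \<in> carrier M" "x \<notin> I" using submodule_subset[OF I'] by auto
  obtain S :: "('r, (nat \<Rightarrow> 'm) set) module" and g where
    S: "simple_module R S" and inj: "M_injective R M S" and g: "g \<in> Hom R M S"
    and gI: "\<And>t. t \<in> I \<Longrightarrow> g t = \<zero>\<^bsub>S\<^esub>" and gx: "g x \<noteq> \<zero>\<^bsub>S\<^esub>"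
    using separating_Hom[OF I' x] by metis
  have S': "left_module R S" using S by (simp add: simple_module_def)
  let ?F = "f ` carrier M"
  have F: "submodule ?F R M"
    by (rule image_submodule[OF left_module_axioms left_module_axioms f(1) carrier_submodule])
  \<comment> \<open>\<open>k\<close> sends f(a) to g(a), which is unambiguous because
    \<open>f\<close> is injective.\<close>
  define k where "k = (\<lambda>y\<in>?F. g (inv_into (carrier M) f y))"
  have k: "k (f a) = g a" if "a \<in> carrier M" for a
    using that f(2) by (simp add: k_def)
  have "k \<in> Hom R (restrict_module M ?F) S"
  proof (rule HomI)
    fix a b assume "a \<in> carrier (restrict_module M ?F)" "b \<in> carrier (restrict_module M ?F)"
    then obtain c d where cd: "c \<in> carrier M" "d \<in> carrier M" "a = f c" "b = f d" by auto
    then show "k (a \<oplus>\<^bsub>restrict_module M ?F\<^esub> b) = k a \<oplus>\<^bsub>S\<^esub> k b"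
      using k[of "c \<oplus>\<^bsub>M\<^esub> d"] by (simp add: k Hom_add[OF f(1)] Hom_add[OF g])
  next
    fix r a assume "r \<in> carrier R" "a \<in> carrier (restrict_module M ?F)"
    then obtain c where cd: "r \<in> carrier R" "c \<in> carrier M" "a = f c" by auto
    then show "k (r \<odot>\<^bsub>restrict_module M ?F\<^esub> a) = r \<odot>\<^bsub>S\<^esub> k a"
      using k[of "r \<odot>\<^bsub>M\<^esub> c"] by (simp add: k Hom_smult[OF f(1)] Hom_smult[OF g])
  qed (use k Hom_closed[OF g] in \<open>auto, auto simp: k_def\<close>)
  then obtain h where h: "h \<in> Hom R M S" "\<forall>y\<in>?F. h y = k y"
    using inj F unfolding M_injective_def by blast
  have "h ` carrier M \<subseteq> restrict g (carrier M) ` carrier M"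
    using simple_module_surj[OF left_module_axioms S g carrier_submodule x(1) gx]
      Hom_closed[OF h(1)] by auto
  then obtain p where p: "p \<in> Hom R M M"
    "\<And>y. y \<in> carrier M \<Longrightarrow> restrict g (carrier M) (p y) = h y"
    using lift_Hom[OF carrier_submodule S'
        restrict_Hom[OF left_module_axioms carrier_submodule g] h(1)] by metis
  have "g x = h (f x)" using h(2) k x(1) by simp
  also have "\<dots> = g (p (f x))" using p(2)[of "f x"] Hom_closed[OF f(1) x(1)] Hom_closed[OF p(1)] by simp
  also have "\<dots> = \<zero>\<^bsub>S\<^esub>"
    using I p(1) f(3) x(1) by (intro gI) (auto simp: fully_invariant_def)
  finally show False using gx by simp
qed

end

section \<open>Goldie's theorem\<close>

lemma add_Hom:
  assumes "left_module R A" "left_module R B" "f \<in> Hom R A B" "g \<in> Hom R A B"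
  shows "(\<lambda>x\<in>carrier A. f x \<oplus>\<^bsub>B\<^esub> g x) \<in> Hom R A B"
proof -
  interpret A: left_module R A by fact
  interpret B: left_module R B by fact
  note [simp] = Hom_closed[OF assms(3)] Hom_closed[OF assms(4)]
  show ?thesis
    by (rule HomI)
      (simp_all add: Hom_add[OF assms(3)] Hom_add[OF assms(4)] Hom_smult[OF assms(3)]
        Hom_smult[OF assms(4)] B.M.a_ac B.smult_r_distr)
qed

lemma zero_Hom:
  assumes "left_module R A" "left_module R B"
  shows "(\<lambda>x\<in>carrier A. \<zero>\<^bsub>B\<^esub>) \<in> Hom R A B"
proof -
  interpret A: left_module R A by fact
  interpret B: left_module R B by fact
  show ?thesis by (rule HomI) simp_all
qed

lemma funpow_closed:
  assumes "\<And>x. x \<in> X \<Longrightarrow> f x \<in> X" "x \<in> X"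
  shows "(f ^^ n) x \<in> X"
  using assms(2) by (induction n) (auto intro: assms(1))

text \<open>Homomorphisms are extensional, whereas \<open>f ^^ 0\<close> is the identity on the
  whole type; hence the \<open>restrict\<close>.\<close>

lemma restrict_funpow_Hom:
  assumes "left_module R M" "f \<in> Hom R M M"
  shows "restrict (f ^^ n) (carrier M) \<in> Hom R M M"
proof (induction n)
  case 0
  interpret left_module R M by fact
  show ?case by (rule HomI) (auto simp: extensional_def restrict_def)
next
  case (Suc n)
  have "restrict (f ^^ Suc n) (carrier M) = compose (carrier M) f (restrict (f ^^ n) (carrier M))"
    by (auto simp: compose_def)
  then show ?case using compose_Hom[OF assms(1,2) Suc] by (simp only:)
qed

lemma fully_invariantD:
  assumes "fully_invariant R M N"
  shows "submodule N R M" "\<lbrakk>f \<in> Hom R M M; x \<in> N\<rbrakk> \<Longrightarrow> f x \<in> N"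
  using assms by (auto simp: fully_invariant_def)

lemma fully_invariant_add:
  assumes "left_module R M" "fully_invariant R M N" "fully_invariant R M K"
  shows "fully_invariant R M (N <+>\<^bsub>M\<^esub> K)"
proof -
  interpret left_module R M by fact
  note N = fully_invariantD[OF assms(2)] and K = fully_invariantD[OF assms(3)]
  have "f a \<in> N <+>\<^bsub>M\<^esub> K" if f: "f \<in> Hom R M M" and "a \<in> N <+>\<^bsub>M\<^esub> K" for f a
  proof -
    obtain b c where "b \<in> N" "c \<in> K" "a = b \<oplus>\<^bsub>M\<^esub> c"
      using \<open>a \<in> N <+>\<^bsub>M\<^esub> K\<close> by (auto simp: set_add_def')
    then have "f a = f b \<oplus>\<^bsub>M\<^esub> f c" "f b \<in> N" "f c \<in> K"
      using Hom_add[OF f] submodule_carrier[OF N(1)] submodule_carrier[OF K(1)] N(2)[OF f] K(2)[OF f]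
      by auto
    then show ?thesis unfolding set_add_def' by blast
  qed
  then show ?thesis
    using add_submodule[OF N(1) K(1)] by (auto simp: fully_invariant_def)
qed

text \<open>This replaces the sum in the product by a condition on single maps M -> K, the form in
  which primeness is used.\<close>

lemma module_prod_subset_iff:
  assumes "left_module R M" "submodule N R M" "submodule K R M" "submodule P R M"
  shows "module_prod R M N K \<subseteq> P \<longleftrightarrow> (\<forall>f\<in>Hom R M M. f ` carrier M \<subseteq> K \<longrightarrow> f ` N \<subseteq> P)"
proof -
  interpret left_module R M by fact
  note KM = submodule_subset[OF assms(3)] and NM = submodule_subset[OF assms(2)]
  have "f ` N \<subseteq> carrier M" if "f \<in> Hom R M (restrict_module M K)" for f
    using that NM KM unfolding Hom_restrict_module_iff[OF KM] by blast
  then have "module_prod R M N K \<subseteq> P \<longleftrightarrow> (\<forall>f\<in>Hom R M (restrict_module M K). f ` N \<subseteq> P)"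
    unfolding module_prod_def by (rule sum_submodules_subset_iff[OF assms(1,4)])
  also have "\<dots> \<longleftrightarrow> (\<forall>f\<in>Hom R M M. f ` carrier M \<subseteq> K \<longrightarrow> f ` N \<subseteq> P)"
    unfolding Ball_def Hom_restrict_module_iff[OF KM] by blast
  finally show ?thesis .
qed

text \<open>The kernel of one endomorphism is a left annihilator. If no kernel were maximal in
  \<open>H\<close>, dependent choice would give an infinite strictly increasing chain of
  them.\<close>

lemma ACC_maximal_kernel:
  assumes "ACC_left_annihilators R M" "H \<subseteq> Hom R M M" "H \<noteq> {}"
  obtains f where "f \<in> H"
    "\<And>g. \<lbrakk>g \<in> H; \<And>x. \<lbrakk>x \<in> carrier M; f x = \<zero>\<^bsub>M\<^esub>\<rbrakk> \<Longrightarrow> g x = \<zero>\<^bsub>M\<^esub>\<rbrakk> \<Longrightarrow>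
      \<forall>x\<in>carrier M. g x = \<zero>\<^bsub>M\<^esub> \<longrightarrow> f x = \<zero>\<^bsub>M\<^esub>"
proof (rule ccontr)
  note thesisI = that
  define ker where "ker f = {x \<in> carrier M. f x = \<zero>\<^bsub>M\<^esub>}" for f
  assume "\<not> thesis"
  have step: "\<exists>g. g \<in> H \<and> ker f \<subset> ker g" if f: "f \<in> H" for f
  proof (rule ccontr)
    assume max: "\<nexists>g. g \<in> H \<and> ker f \<subset> ker g"
    have thesis
    proof (rule thesisI[OF f])
      fix g assume "g \<in> H" "\<And>x. \<lbrakk>x \<in> carrier M; f x = \<zero>\<^bsub>M\<^esub>\<rbrakk> \<Longrightarrow> g x = \<zero>\<^bsub>M\<^esub>"
      then have "g \<in> H" "ker f \<subseteq> ker g" by (auto simp: ker_def)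
      then have "ker f = ker g" using max by (meson psubsetI)
      then show "\<forall>x\<in>carrier M. g x = \<zero>\<^bsub>M\<^esub> \<longrightarrow> f x = \<zero>\<^bsub>M\<^esub>" by (auto simp: ker_def)
    qed
    with \<open>\<not> thesis\<close> show False ..
  qed
  have "\<exists>F. \<forall>n. F n \<in> H \<and> ker (F n) \<subset> ker (F (Suc n))"
  proof (rule dependent_nat_choice)
    show "\<exists>f. f \<in> H" using assms(3) by blast
  qed (rule step)
  then obtain F where F: "\<And>n. F n \<in> H" "\<And>n. ker (F n) \<subset> ker (F (Suc n))" by metis
  have "left_annihilator_in R M (ker (F n))" for n
    unfolding left_annihilator_in_def ker_def
  proof (intro exI[of _ "{F n}"] conjI)
    show "{F n} \<subseteq> Hom R M M" using F(1) assms(2) by blast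
  qed simp
  then have "\<exists>k. \<forall>i\<ge>k. ker (F i) = ker (F k)"
    using assms(1)[unfolded ACC_left_annihilators_def, THEN spec, of "\<lambda>n. ker (F n)"] F(2)
    by (simp add: psubset_imp_subset)
  then obtain k where "\<forall>i\<ge>k. ker (F i) = ker (F k)" ..
  then have "ker (F (Suc k)) = ker (F k)" using le_SucI[OF order_refl] by blast
  then show False using F(2)[of k] by simp
qed

section \<open>Non-nilpotent and stable endomorphisms\<close>

context projective_co_semisimple
begin

lemma ex_nonzero_Hom:
  assumes "submodule N R M" "N \<noteq> {\<zero>\<^bsub>M\<^esub>}"
  obtains f x where "f \<in> Hom R M M" "f ` carrier M \<subseteq> N" "x \<in> carrier M" "f x \<noteq> \<zero>\<^bsub>M\<^esub>"
proof -
  obtain x where x: "x \<in> N" "x \<noteq> \<zero>\<^bsub>M\<^esub>"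
    using assms(2) submodule_zero[OF assms(1)] by blast
  have "\<exists>f\<in>Hom R M M. f ` carrier M \<subseteq> N \<and> f x \<noteq> \<zero>\<^bsub>M\<^esub>"
    using mem_if_Hom_images_mem[OF assms(1) x(1) zero_submodule] x(2) by blast
  then show ?thesis using that submodule_carrier[OF assms(1) x(1)] by blast
qed

text \<open>If all maps \<open>M \<rightarrow> N\<close> were nilpotent, a nonzero one \<open>f\<close> of maximal kernel would satisfy \<open>f s f = 0\<close>
  for all endomorphisms \<open>s\<close>, because the last nonzero \<open>(f s)\<^sup>i f\<close> has the same kernel as \<open>f\<close>. But all maps
  \<open>M \<rightarrow> f(M)\<close> are of the form \<open>f s\<close>.\<close>

lemma ex_non_nilpotent_Hom:
  assumes ACC: "ACC_left_annihilators R M" and N: "submodule N R M" "N \<noteq> {\<zero>\<^bsub>M\<^esub>}"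
  obtains f where "f \<in> Hom R M M" "f ` carrier M \<subseteq> N"
    "\<And>n. \<exists>x\<in>carrier M. (f ^^ n) x \<noteq> \<zero>\<^bsub>M\<^esub>"
proof (rule ccontr)
  note thesisI = that
  assume "\<not> thesis"
  have nil: "\<exists>n. \<forall>x\<in>carrier M. (f ^^ n) x = \<zero>\<^bsub>M\<^esub>"
    if f: "f \<in> Hom R M M" "f ` carrier M \<subseteq> N" for f
  proof (rule ccontr)
    assume "\<nexists>n. \<forall>x\<in>carrier M. (f ^^ n) x = \<zero>\<^bsub>M\<^esub>"
    then have "\<exists>x\<in>carrier M. (f ^^ n) x \<noteq> \<zero>\<^bsub>M\<^esub>" for n by blast
    then have thesis by (rule thesisI[OF f])
    with \<open>\<not> thesis\<close> show False ..
  qed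
  define H where "H = {f \<in> Hom R M M. f ` carrier M \<subseteq> N \<and> (\<exists>x\<in>carrier M. f x \<noteq> \<zero>\<^bsub>M\<^esub>)}"
  obtain f\<^sub>0 x where "f\<^sub>0 \<in> Hom R M M" "f\<^sub>0 ` carrier M \<subseteq> N" "x \<in> carrier M" "f\<^sub>0 x \<noteq> \<zero>\<^bsub>M\<^esub>"
    by (rule ex_nonzero_Hom[OF N])
  then have "f\<^sub>0 \<in> H" unfolding H_def by blast
  then have "H \<noteq> {}" by blast
  moreover have "H \<subseteq> Hom R M M" by (auto simp: H_def)
  ultimately obtain f where f: "f \<in> H" and
    max: "\<And>g. \<lbrakk>g \<in> H; \<And>x. \<lbrakk>x \<in> carrier M; f x = \<zero>\<^bsub>M\<^esub>\<rbrakk> \<Longrightarrow> g x = \<zero>\<^bsub>M\<^esub>\<rbrakk> \<Longrightarrow>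
      \<forall>x\<in>carrier M. g x = \<zero>\<^bsub>M\<^esub> \<longrightarrow> f x = \<zero>\<^bsub>M\<^esub>"
    using ACC_maximal_kernel[OF ACC, of H] by blast
  from f obtain x\<^sub>0 where fH: "f \<in> Hom R M M" and fN: "f ` carrier M \<subseteq> N"
    and x\<^sub>0: "x\<^sub>0 \<in> carrier M" "f x\<^sub>0 \<noteq> \<zero>\<^bsub>M\<^esub>"
    by (auto simp: H_def)
  note fM = Hom_closed[OF fH]
  have fsf: "f (s (f x)) = \<zero>\<^bsub>M\<^esub>" if s: "s \<in> Hom R M M" and x: "x \<in> carrier M" for s x
  proof -
    note sM = Hom_closed[OF s]
    define t where "t = compose (carrier M) f s"
    have t: "t \<in> Hom R M M"
      unfolding t_def by (rule compose_Hom[OF left_module_axioms fH s])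
    have tN: "t y \<in> N" if "y \<in> carrier M" for y
      using that sM fN by (auto simp: t_def compose_eq)
    obtain n where n: "\<forall>x\<in>carrier M. (t ^^ n) x = \<zero>\<^bsub>M\<^esub>" using nil[OF t] tN by blast
    define P where "P = (\<lambda>j. \<forall>x\<in>carrier M. (t ^^ j) (f x) = \<zero>\<^bsub>M\<^esub>)"
    have "P n" using n fM by (simp add: P_def)
    moreover have "\<not> P 0" using x\<^sub>0 by (auto simp: P_def)
    ultimately obtain i where i: "\<not> P i" "P (Suc i)"
      using ex_least_nat_less[of P n] by (metis le_refl)
    define g where "g = compose (carrier M) (restrict (t ^^ i) (carrier M)) f"
    have g: "g y = (t ^^ i) (f y)" if "y \<in> carrier M" for y
      using that fM by (simp add: g_def compose_eq)
    have "g \<in> Hom R M M"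
      unfolding g_def by (rule compose_Hom[OF left_module_axioms restrict_funpow_Hom[OF left_module_axioms t] fH])
    moreover have "g ` carrier M \<subseteq> N"
      using fN funpow_closed[of N t] tN submodule_carrier[OF N(1)] by (auto simp: g image_subset_iff)
    ultimately have "g \<in> H" using i(1) by (auto simp: H_def P_def g)
    moreover have "g y = \<zero>\<^bsub>M\<^esub>" if "y \<in> carrier M" "f y = \<zero>\<^bsub>M\<^esub>" for y
      using that Hom_zero[OF left_module_axioms left_module_axioms restrict_funpow_Hom[OF left_module_axioms t]]
      by (simp add: g)
    ultimately have ker: "\<forall>y\<in>carrier M. g y = \<zero>\<^bsub>M\<^esub> \<longrightarrow> f y = \<zero>\<^bsub>M\<^esub>" by (rule max)
    \<comment> \<open>With g = (f s)^i f this is (f s)^(i+1) f, which vanishes by the choice of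
      \<open>i\<close>. Hence s(f(x)) lies in the kernel of \<open>g\<close>, which is contained in
      that of \<open>f\<close>.\<close>
    have "g (s (f x)) = (t ^^ Suc i) (f x)"
      using x fM sM unfolding funpow_Suc_right by (simp add: g) (simp add: t_def compose_eq)
    also have "\<dots> = \<zero>\<^bsub>M\<^esub>" using i(2) x by (simp add: P_def)
    finally show ?thesis using ker x fM sM by blast
  qed
  have "f x\<^sub>0 \<in> {\<zero>\<^bsub>M\<^esub>}"
  proof (rule mem_if_Hom_images_mem[OF _ _ zero_submodule])
    show "submodule (f ` carrier M) R M"
      by (rule image_submodule[OF left_module_axioms left_module_axioms fH carrier_submodule])
    show "f x\<^sub>0 \<in> f ` carrier M" using x\<^sub>0 by simp
    fix \<phi> assume \<phi>: "\<phi> \<in> Hom R M M" "\<phi> ` carrier M \<subseteq> f ` carrier M"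
    have "restrict_module M (carrier M) = M" by (simp add: restrict_module_def)
    then obtain s where "s \<in> Hom R M M" "\<And>x. x \<in> carrier M \<Longrightarrow> f (s x) = \<phi> x"
      using lift_Hom[OF carrier_submodule left_module_axioms _ \<phi>(1), of f] fH \<phi>(2) by metis
    then show "\<phi> (f x\<^sub>0) \<in> {\<zero>\<^bsub>M\<^esub>}" using fsf[of s x\<^sub>0] fM x\<^sub>0 by simp
  qed
  then show False using x\<^sub>0 by simp
qed

text \<open>Take \<open>f\<close> of maximal kernel among the non-nilpotent maps M -> N. Its square
  is also non-nilpotent and kills the kernel of \<open>f\<close>, so both kernels agree. Thus
  \<open>f\<close> is injective on its image, which is what the independence of images
  requires.\<close>

lemma ex_stable_Hom:
  assumes ACC: "ACC_left_annihilators R M" and N: "submodule N R M" "N \<noteq> {\<zero>\<^bsub>M\<^esub>}"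
  obtains f where "f \<in> Hom R M M" "f ` carrier M \<subseteq> N" "\<exists>x\<in>carrier M. f x \<noteq> \<zero>\<^bsub>M\<^esub>"
    "\<And>x. \<lbrakk>x \<in> carrier M; f (f x) = \<zero>\<^bsub>M\<^esub>\<rbrakk> \<Longrightarrow> f x = \<zero>\<^bsub>M\<^esub>"
proof -
  define H where "H = {f \<in> Hom R M M. f ` carrier M \<subseteq> N \<and>
    (\<forall>n. \<exists>x\<in>carrier M. (f ^^ n) x \<noteq> \<zero>\<^bsub>M\<^esub>)}"
  obtain f\<^sub>0 where "f\<^sub>0 \<in> Hom R M M" "f\<^sub>0 ` carrier M \<subseteq> N"
    "\<And>n. \<exists>x\<in>carrier M. (f\<^sub>0 ^^ n) x \<noteq> \<zero>\<^bsub>M\<^esub>"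
    by (rule ex_non_nilpotent_Hom[OF assms]) blast
  then have "f\<^sub>0 \<in> H" by (simp add: H_def)
  then have "H \<noteq> {}" by blast
  moreover have "H \<subseteq> Hom R M M" by (auto simp: H_def)
  ultimately obtain f where f: "f \<in> H" and
    max: "\<And>g. \<lbrakk>g \<in> H; \<And>x. \<lbrakk>x \<in> carrier M; f x = \<zero>\<^bsub>M\<^esub>\<rbrakk> \<Longrightarrow> g x = \<zero>\<^bsub>M\<^esub>\<rbrakk> \<Longrightarrow>
      \<forall>x\<in>carrier M. g x = \<zero>\<^bsub>M\<^esub> \<longrightarrow> f x = \<zero>\<^bsub>M\<^esub>"
    using ACC_maximal_kernel[OF ACC, of H] by blast
  then have fH: "f \<in> Hom R M M" and fN: "f ` carrier M \<subseteq> N"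
    and non_nil: "\<And>n. \<exists>x\<in>carrier M. (f ^^ n) x \<noteq> \<zero>\<^bsub>M\<^esub>"
    by (auto simp: H_def)
  note fM = Hom_closed[OF fH]
  define g where "g = compose (carrier M) f f"
  have g: "g x = f (f x)" if "x \<in> carrier M" for x using that by (simp add: g_def compose_eq)
  have gn: "(g ^^ n) x = (f ^^ (n + n)) x" if "x \<in> carrier M" for n x
    using that
  proof (induction n)
    case (Suc n)
    then show ?case using g[of "(f ^^ (n + n)) x"] funpow_closed[of "carrier M" f x] fM by simp
  qed simp
  have "g \<in> Hom R M M" unfolding g_def by (rule compose_Hom[OF left_module_axioms fH fH])
  moreover have "g ` carrier M \<subseteq> N" using fN fM by (auto simp: g)
  moreover have "\<exists>x\<in>carrier M. (g ^^ n) x \<noteq> \<zero>\<^bsub>M\<^esub>" for n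
    using non_nil[of "n + n"] gn by auto
  ultimately have "g \<in> H" by (simp add: H_def)
  moreover have "g x = \<zero>\<^bsub>M\<^esub>" if "x \<in> carrier M" "f x = \<zero>\<^bsub>M\<^esub>" for x
    using that Hom_zero[OF left_module_axioms left_module_axioms fH] by (simp add: g)
  ultimately have "\<forall>x\<in>carrier M. g x = \<zero>\<^bsub>M\<^esub> \<longrightarrow> f x = \<zero>\<^bsub>M\<^esub>" by (rule max)
  then show ?thesis
    using that[OF fH fN] non_nil[of 1] g by auto
qed

end

text \<open>The sum of the images is direct because applying \<open>f i\<close> to a relation kills all terms of index
  greater than \<open>i\<close>.\<close>

lemma independent_images:
  fixes R :: "('r, 'x) ring_scheme" and M :: "('r, 'm) module" and f :: "nat \<Rightarrow> 'm \<Rightarrow> 'm"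
  assumes "left_module R M" and Hom: "\<And>i. f i \<in> Hom R M M"
    and comp_zero: "\<And>i j x. \<lbrakk>i < j; x \<in> carrier M\<rbrakk> \<Longrightarrow> f i (f j x) = \<zero>\<^bsub>M\<^esub>"
    and stable: "\<And>i x. \<lbrakk>x \<in> carrier M; f i (f i x) = \<zero>\<^bsub>M\<^esub>\<rbrakk> \<Longrightarrow> f i x = \<zero>\<^bsub>M\<^esub>"
    and "finite F" "\<And>i. i \<in> F \<Longrightarrow> y i \<in> f i ` carrier M" "finsum M y F = \<zero>\<^bsub>M\<^esub>"
  shows "\<forall>i\<in>F. y i = \<zero>\<^bsub>M\<^esub>"
proof -
  interpret left_module R M by fact
  note fM = Hom_closed[OF Hom]
  show ?thesis
    using assms(5-7)
  proof (induction F rule: finite_linorder_min_induct)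
    \<comment> \<open>The new index \<open>b\<close> is smaller than all those in \<open>A\<close>,
      so \<open>f b\<close> annihilates the rest of the sum.\<close>
    case (insert b A)
    have yM: "y i \<in> carrier M" if "i \<in> insert b A" for i
      using insert.prems(1)[OF that] fM by auto
    have "b \<notin> A" using insert.hyps by auto
    then have sum: "finsum M y (insert b A) = y b \<oplus>\<^bsub>M\<^esub> finsum M y A"
      using insert.hyps(1) yM by (intro M.finsum_insert) auto
    let ?K = "{x \<in> carrier M. f b x = \<zero>\<^bsub>M\<^esub>}"
    have K: "submodule ?K R M"
      by (rule kernel_submodule[OF assms(1) assms(1) Hom])
    have "finsum M y A \<in> ?K"
    proof (rule finsum_submodule[OF K insert.hyps(1)])
      fix i assume i: "i \<in> A"
      then obtain x where "x \<in> carrier M" "y i = f i x" using insert.prems(1) by blast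
      then show "y i \<in> ?K" using insert.hyps(2) i comp_zero fM by auto
    qed
    then have A: "finsum M y A \<in> carrier M" "f b (finsum M y A) = \<zero>\<^bsub>M\<^esub>" by auto
    have "f b (y b) = f b (y b \<oplus>\<^bsub>M\<^esub> finsum M y A)"
      using A yM fM by (simp add: Hom_add[OF Hom])
    also have "\<dots> = \<zero>\<^bsub>M\<^esub>"
      using insert.prems(2) sum Hom_zero[OF assms(1,1) Hom] by simp
    finally have "f b (y b) = \<zero>\<^bsub>M\<^esub>" .
    then have yb: "y b = \<zero>\<^bsub>M\<^esub>" using stable insert.prems(1)[of b] by auto
    then have "finsum M y A = \<zero>\<^bsub>M\<^esub>" using insert.prems(2) sum A(1) by simp
    then show ?case using insert.IH insert.prems(1) yb by auto
  qed simp
qed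

lemma not_finite_uniform_dimension:
  fixes R :: "('r, 'x) ring_scheme" and M :: "('r, 'm) module" and f :: "nat \<Rightarrow> 'm \<Rightarrow> 'm"
  assumes "left_module R M" and Hom: "\<And>i. f i \<in> Hom R M M"
    and comp_zero: "\<And>i j x. \<lbrakk>i < j; x \<in> carrier M\<rbrakk> \<Longrightarrow> f i (f j x) = \<zero>\<^bsub>M\<^esub>"
    and stable: "\<And>i x. \<lbrakk>x \<in> carrier M; f i (f i x) = \<zero>\<^bsub>M\<^esub>\<rbrakk> \<Longrightarrow> f i x = \<zero>\<^bsub>M\<^esub>"
    and nonzero: "\<And>i. \<exists>x\<in>carrier M. f i x \<noteq> \<zero>\<^bsub>M\<^esub>"
  shows "\<not> finite_uniform_dimension R M"
proof -
  interpret left_module R M by fact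
  define U where "U i = f i ` carrier M" for i
  have U: "submodule (U i) R M" for i
    unfolding U_def by (rule image_submodule[OF assms(1,1) Hom carrier_submodule])
  moreover have "U i \<noteq> {\<zero>\<^bsub>M\<^esub>}" for i using nonzero[of i] by (auto simp: U_def)
  moreover have "U i \<inter> sum_submodules M (- {i}) U = {\<zero>\<^bsub>M\<^esub>}" for i
  proof
    have "\<zero>\<^bsub>M\<^esub> \<in> sum_submodules M (- {i}) U"
      by (rule zero_mem_sum_submodules[OF assms(1)])
    then show "{\<zero>\<^bsub>M\<^esub>} \<subseteq> U i \<inter> sum_submodules M (- {i}) U"
      using submodule_zero[OF U] by simp
    show "U i \<inter> sum_submodules M (- {i}) U \<subseteq> {\<zero>\<^bsub>M\<^esub>}"
    proof
      fix a assume "a \<in> U i \<inter> sum_submodules M (- {i}) U"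
      then obtain x F where a: "a \<in> U i" "a = finsum M x F"
        and F: "finite F" "F \<subseteq> - {i}" "\<forall>j\<in>F. x j \<in> U j"
        unfolding sum_submodules_def by blast
      note UM = submodule_carrier[OF U]
      \<comment> \<open>An element common to \<open>U i\<close> and the sum of the others yields a
        vanishing sum: -a is put at the new index \<open>i\<close>.\<close>
      define y where "y = x(i := \<ominus>\<^bsub>M\<^esub> a)"
      have yF: "finsum M y F = a"
        unfolding a(2) using F UM by (intro M.finsum_cong') (auto simp: y_def)
      have y: "y j \<in> U j" if "j \<in> insert i F" for j
        using that F a(1) submodule_neg[OF U] by (auto simp: y_def)
      have "finsum M y (insert i F) = y i \<oplus>\<^bsub>M\<^esub> finsum M y F"
        using F y UM by (intro M.finsum_insert) auto
      also have "\<dots> = \<zero>\<^bsub>M\<^esub>"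
        using yF UM[OF a(1)] by (simp add: y_def M.l_neg)
      finally have "\<forall>j\<in>insert i F. y j = \<zero>\<^bsub>M\<^esub>"
        using y F(1) by (intro independent_images[OF assms(1) Hom comp_zero stable]) (auto simp: U_def)
      then have "\<ominus>\<^bsub>M\<^esub> a = \<zero>\<^bsub>M\<^esub>" by (simp add: y_def)
      then show "a \<in> {\<zero>\<^bsub>M\<^esub>}" using M.r_neg[OF UM[OF a(1)]] UM[OF a(1)] by simp
    qed
  qed
  ultimately show ?thesis unfolding finite_uniform_dimension_def by blast
qed

text \<open>The map \<open>c\<close> is the sum of the \<open>f i\<close>, built from the last index
  downwards. After index k has been treated, all earlier \<open>f i\<close> kill the image of
  \<open>c\<close>, and the kernel of \<open>c\<close> lies in those of the later ones. When f_k(x)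
  + c(x) = 0, applying f_k leaves f_k(f_k(x)) = 0, so f_k(x) = 0 by stability and then c(x) =
  0.\<close>

lemma ex_jointly_injective_Hom:
  fixes R :: "('r, 'x) ring_scheme" and M :: "('r, 'm) module" and f :: "nat \<Rightarrow> 'm \<Rightarrow> 'm"
  assumes "left_module R M" and I: "submodule I R M"
    and f: "\<And>i. i < n \<Longrightarrow> f i \<in> Hom R M M" "\<And>i. i < n \<Longrightarrow> f i ` carrier M \<subseteq> I"
    and comp_zero: "\<And>i j x. \<lbrakk>i < j; j < n; x \<in> carrier M\<rbrakk> \<Longrightarrow> f i (f j x) = \<zero>\<^bsub>M\<^esub>"
    and stable: "\<And>i x. \<lbrakk>i < n; x \<in> carrier M; f i (f i x) = \<zero>\<^bsub>M\<^esub>\<rbrakk> \<Longrightarrow> f i x = \<zero>\<^bsub>M\<^esub>"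
  obtains c where "c \<in> Hom R M M" "c ` carrier M \<subseteq> I"
    "\<And>x i. \<lbrakk>x \<in> carrier M; c x = \<zero>\<^bsub>M\<^esub>; i < n\<rbrakk> \<Longrightarrow> f i x = \<zero>\<^bsub>M\<^esub>"
proof -
  interpret left_module R M by fact
  have "\<exists>c\<in>Hom R M M. c ` carrier M \<subseteq> I \<and> (\<forall>x\<in>carrier M. \<forall>i<k. f i (c x) = \<zero>\<^bsub>M\<^esub>) \<and>
      (\<forall>x\<in>carrier M. c x = \<zero>\<^bsub>M\<^esub> \<longrightarrow> (\<forall>i<n. k \<le> i \<longrightarrow> f i x = \<zero>\<^bsub>M\<^esub>))"
    if "k \<le> n" for k
    using that
  proof (induction rule: inc_induct)
    case base
    have "f i \<zero>\<^bsub>M\<^esub> = \<zero>\<^bsub>M\<^esub>" if "i < n" for i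
      by (rule Hom_zero[OF assms(1,1) f(1)[OF that]])
    then show ?case
      using submodule_zero[OF I] by (intro bexI[OF _ zero_Hom[OF assms(1,1)]]) auto
  next
    case (step k)
    then obtain c where c: "c \<in> Hom R M M" "c ` carrier M \<subseteq> I"
      and zero: "\<And>x i. \<lbrakk>x \<in> carrier M; i < Suc k\<rbrakk> \<Longrightarrow> f i (c x) = \<zero>\<^bsub>M\<^esub>"
      and ker: "\<And>x i. \<lbrakk>x \<in> carrier M; c x = \<zero>\<^bsub>M\<^esub>; i < n; Suc k \<le> i\<rbrakk> \<Longrightarrow> f i x = \<zero>\<^bsub>M\<^esub>"
      by blast
    note k = f[OF step.hyps(2)]
    note kM = Hom_closed[OF k(1)] and cM = Hom_closed[OF c(1)]
    let ?d = "\<lambda>x\<in>carrier M. f k x \<oplus>\<^bsub>M\<^esub> c x"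
    show ?case
    proof (intro bexI[of _ ?d] conjI ballI allI impI)
      show "?d \<in> Hom R M M" by (rule add_Hom[OF assms(1,1) k(1) c(1)])
      show "?d ` carrier M \<subseteq> I"
        using k(2) c(2) submodule_add[OF I] by (simp add: image_subset_iff)
      fix x assume x: "x \<in> carrier M"
      show "f i (?d x) = \<zero>\<^bsub>M\<^esub>" if "i < k" for i
        using that x kM cM zero[of x i] comp_zero[of i k x] step.hyps(2) Hom_add[OF f(1)[of i]]
        by simp
      fix i assume d: "?d x = \<zero>\<^bsub>M\<^esub>" and i: "i < n" "k \<le> i"
      have "f k (f k x) = f k (?d x)"
        using x kM cM zero[of x k] Hom_add[OF k(1)] by simp
      then have "f k (f k x) = \<zero>\<^bsub>M\<^esub>" using d Hom_zero[OF assms(1,1) k(1)] by simp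
      then have fk: "f k x = \<zero>\<^bsub>M\<^esub>" using stable step.hyps(2) x by blast
      then have "c x = \<zero>\<^bsub>M\<^esub>" using d x cM by simp
      then show "f i x = \<zero>\<^bsub>M\<^esub>" using fk ker[OF x _ i(1)] i(2) by (cases "i = k") auto
    qed
  qed
  from this[of 0] show ?thesis using that by (auto 0 3)
qed

lemma Hom_inj_on:
  assumes "left_module R M" "left_module R B" "f \<in> Hom R M B"
    "\<And>x. \<lbrakk>x \<in> carrier M; f x = \<zero>\<^bsub>B\<^esub>\<rbrakk> \<Longrightarrow> x = \<zero>\<^bsub>M\<^esub>"
  shows "inj_on f (carrier M)"
proof (rule inj_onI)
  interpret M: left_module R M by fact
  interpret B: left_module R B by fact
  fix x y assume xy: "x \<in> carrier M" "y \<in> carrier M" "f x = f y"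
  then have "f (x \<ominus>\<^bsub>M\<^esub> y) = \<zero>\<^bsub>B\<^esub>"
    using Hom_minus[OF assms(1-3)] B.minus_eq_zero_iff Hom_closed[OF assms(3)] by simp
  then have "x \<ominus>\<^bsub>M\<^esub> y = \<zero>\<^bsub>M\<^esub>" using assms(4) xy by simp
  then show "x = y" using M.minus_eq_zero_iff xy by simp
qed

section \<open>Essential fully invariant submodules\<close>

context projective_co_semisimple
begin

text \<open>Choose stable nonzero maps into \<open>I\<close> one after another, each with image in
  the common kernel L of its predecessors. Their images are independent, so the choice stops by
  finite uniform dimension. By \<open>ex_stable_Hom\<close> it stops only when L meets
  \<open>I\<close> in zero, so L is zero by essentiality. A map vanishing only on L is then a
  monomorphism into \<open>I\<close>, and \<open>fully_invariant_eq_carrier\<close> applies.\<close>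

lemma essential_fully_invariant_eq_carrier:
  assumes Goldie: "Goldie_module R M" and I: "fully_invariant R M I"
    and essential: "\<And>N. \<lbrakk>submodule N R M; N \<inter> I = {\<zero>\<^bsub>M\<^esub>}\<rbrakk> \<Longrightarrow> N = {\<zero>\<^bsub>M\<^esub>}"
  shows "I = carrier M"
proof -
  note I' = fully_invariantD(1)[OF I]
  have ACC: "ACC_left_annihilators R M" and fud: "finite_uniform_dimension R M"
    using Goldie by (auto simp: Goldie_module_def)
  define L where "L f n = {x \<in> carrier M. \<forall>i<n. f i x = \<zero>\<^bsub>M\<^esub>}" for f :: "nat \<Rightarrow> 'm \<Rightarrow> 'm" and n :: nat
  \<comment> \<open>\<open>Q f n g\<close> says that \<open>g\<close> may be chosen as the next map
    after \<open>f 0\<close>, ..., \<open>f (n - 1)\<close>.\<close>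
  define Q where "Q f n g \<longleftrightarrow> g \<in> Hom R M M \<and> g ` carrier M \<subseteq> I \<inter> L f n \<and>
    (\<exists>x\<in>carrier M. g x \<noteq> \<zero>\<^bsub>M\<^esub>) \<and> (\<forall>x\<in>carrier M. g (g x) = \<zero>\<^bsub>M\<^esub> \<longrightarrow> g x = \<zero>\<^bsub>M\<^esub>)" for f n g
  have Q: "g \<in> Hom R M M" "g ` carrier M \<subseteq> I" "\<exists>x\<in>carrier M. g x \<noteq> \<zero>\<^bsub>M\<^esub>"
    "\<And>x. \<lbrakk>x \<in> carrier M; g (g x) = \<zero>\<^bsub>M\<^esub>\<rbrakk> \<Longrightarrow> g x = \<zero>\<^bsub>M\<^esub>"
    "\<And>x i. \<lbrakk>x \<in> carrier M; i < n\<rbrakk> \<Longrightarrow> f i (g x) = \<zero>\<^bsub>M\<^esub>" if "Q f n g" for f n g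
    using that by (auto simp: Q_def L_def)
  have "\<exists>f n. (\<forall>i<n. Q f i (f i)) \<and> (\<nexists>g. Q f n g)"
  proof (rule ccontr)
    assume "\<not> ?thesis"
    then have step: "\<exists>g. Q f n g" if "\<And>i. (i, n) \<in> less_than \<Longrightarrow> Q f i (f i)" for f n
      using that by auto
    \<comment> \<open>Each choice depends on all earlier ones, hence well-founded choice; its side
      condition holds because \<open>Q f n\<close> looks at \<open>f\<close> only below
      \<open>n\<close>.\<close>
    have "\<exists>f. \<forall>n. Q f n (f n)"
    proof (rule dependent_wf_choice[OF wf_less_than])
      fix f g :: "nat \<Rightarrow> 'm \<Rightarrow> 'm" and n h assume "\<And>i. (i, n) \<in> less_than \<Longrightarrow> f i = g i"
      then have "L f n = L g n" by (auto simp: L_def)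
      then show "Q f n h = Q g n h" by (simp add: Q_def)
    qed (rule step)
    then obtain f where f: "\<And>n. Q f n (f n)" by blast
    have "\<not> finite_uniform_dimension R M"
      using Q(1)[OF f] Q(5)[OF f] Q(4)[OF f] Q(3)[OF f]
      by (rule not_finite_uniform_dimension[OF left_module_axioms])
    then show False using fud by simp
  qed
  then obtain f n where f: "\<And>i. i < n \<Longrightarrow> Q f i (f i)" and no: "\<And>g. \<not> Q f n g" by blast
  have L: "submodule (L f n) R M"
  proof (rule submoduleI)
    show "\<zero>\<^bsub>M\<^esub> \<in> L f n"
      using Hom_zero[OF left_module_axioms left_module_axioms Q(1)[OF f]] by (auto simp: L_def)
  qed (auto simp: L_def Hom_add[OF Q(1)[OF f]] Hom_smult[OF Q(1)[OF f]])
  have "L f n \<inter> I = {\<zero>\<^bsub>M\<^esub>}"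
  proof (rule ccontr)
    assume "L f n \<inter> I \<noteq> {\<zero>\<^bsub>M\<^esub>}"
    then obtain g where "g \<in> Hom R M M" "g ` carrier M \<subseteq> L f n \<inter> I" "\<exists>x\<in>carrier M. g x \<noteq> \<zero>\<^bsub>M\<^esub>"
      "\<And>x. \<lbrakk>x \<in> carrier M; g (g x) = \<zero>\<^bsub>M\<^esub>\<rbrakk> \<Longrightarrow> g x = \<zero>\<^bsub>M\<^esub>"
      using ex_stable_Hom[OF ACC Int_submodule[OF L I']] by blast
    then have "Q f n g" unfolding Q_def by blast
    then show False using no by simp
  qed
  then have L0: "L f n = {\<zero>\<^bsub>M\<^esub>}" by (rule essential[OF L])
  obtain c where c: "c \<in> Hom R M M" "c ` carrier M \<subseteq> I"
    "\<And>x i. \<lbrakk>x \<in> carrier M; c x = \<zero>\<^bsub>M\<^esub>; i < n\<rbrakk> \<Longrightarrow> f i x = \<zero>\<^bsub>M\<^esub>"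
    by (rule ex_jointly_injective_Hom[OF left_module_axioms I' Q(1)[OF f] Q(2)[OF f] _ Q(4)[OF f]])
      (auto simp: Q(5)[OF f])
  have "inj_on c (carrier M)"
  proof (rule Hom_inj_on[OF left_module_axioms left_module_axioms c(1)])
    fix x assume "x \<in> carrier M" "c x = \<zero>\<^bsub>M\<^esub>"
    then have "x \<in> L f n" using c(3) by (simp add: L_def)
    then show "x = \<zero>\<^bsub>M\<^esub>" using L0 by simp
  qed
  then show ?thesis using fully_invariant_eq_carrier[OF I c(1) _ c(2)] by simp
qed

section \<open>Fully invariant and prime submodules\<close>

lemma fully_invariant_complement:
  assumes Goldie: "Goldie_module R M" and I: "fully_invariant R M I"
  obtains J where "fully_invariant R M J" "I \<inter> J = {\<zero>\<^bsub>M\<^esub>}" "I <+>\<^bsub>M\<^esub> J = carrier M"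
proof -
  note I' = fully_invariantD[OF I]
  define J where "J = {x \<in> carrier M. \<forall>f\<in>Hom R M M. f ` carrier M \<subseteq> I \<longrightarrow> f x = \<zero>\<^bsub>M\<^esub>}"
  have "submodule J R M"
  proof (rule submoduleI)
    fix x y assume "x \<in> J" "y \<in> J"
    then have xy: "x \<in> carrier M" "y \<in> carrier M" by (simp_all add: J_def)
    have "f (x \<oplus>\<^bsub>M\<^esub> y) = \<zero>\<^bsub>M\<^esub>" if f: "f \<in> Hom R M M" "f ` carrier M \<subseteq> I" for f
    proof -
      have "f x = \<zero>\<^bsub>M\<^esub>" "f y = \<zero>\<^bsub>M\<^esub>"
        using \<open>x \<in> J\<close> \<open>y \<in> J\<close> f by (auto simp: J_def)
      then show ?thesis using Hom_add[OF f(1) xy] by simp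
    qed
    then show "x \<oplus>\<^bsub>M\<^esub> y \<in> J" using xy by (simp add: J_def)
  qed (auto simp: J_def Hom_smult Hom_zero[OF left_module_axioms left_module_axioms])
  moreover have "s x \<in> J" if s: "s \<in> Hom R M M" and x: "x \<in> J" for s x
  proof -
    have xM: "x \<in> carrier M" using x by (simp add: J_def)
    have "f (s x) = \<zero>\<^bsub>M\<^esub>" if f: "f \<in> Hom R M M" "f ` carrier M \<subseteq> I" for f
    proof -
      have "compose (carrier M) f s \<in> Hom R M M" by (rule compose_Hom[OF left_module_axioms f(1) s])
      moreover have "compose (carrier M) f s ` carrier M \<subseteq> I"
        using f(2) Hom_closed[OF s] by (auto simp: compose_eq)
      ultimately have "compose (carrier M) f s x = \<zero>\<^bsub>M\<^esub>" using x by (simp add: J_def)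
      then show ?thesis using xM by (simp add: compose_eq)
    qed
    then show ?thesis using Hom_closed[OF s xM] by (simp add: J_def)
  qed
  ultimately have J: "fully_invariant R M J" by (auto simp: fully_invariant_def)
  note J' = fully_invariantD[OF J]
  have IJ: "I \<inter> J = {\<zero>\<^bsub>M\<^esub>}"
  proof
    show "I \<inter> J \<subseteq> {\<zero>\<^bsub>M\<^esub>}"
    proof
      fix x assume "x \<in> I \<inter> J"
      then have "x \<in> I" "x \<in> J" by auto
      \<comment> \<open>By definition of \<open>J\<close> every map M -> I kills \<open>x\<close>;
        since \<open>x\<close> lies in \<open>I\<close>, it must be zero.\<close>
      show "x \<in> {\<zero>\<^bsub>M\<^esub>}"
        by (rule mem_if_Hom_images_mem[OF I'(1) \<open>x \<in> I\<close> zero_submodule]) (use \<open>x \<in> J\<close> in \<open>simp add: J_def\<close>)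
    qed
  qed (use submodule_zero I'(1) J'(1) in blast)
  have FI: "fully_invariant R M (I <+>\<^bsub>M\<^esub> J)"
    by (rule fully_invariant_add[OF left_module_axioms I J])
  note sub = subset_add_submodule[OF I'(1) J'(1)]
  have "I <+>\<^bsub>M\<^esub> J = carrier M"
  proof (rule essential_fully_invariant_eq_carrier[OF Goldie FI])
    fix N assume N: "submodule N R M" and NIJ: "N \<inter> (I <+>\<^bsub>M\<^esub> J) = {\<zero>\<^bsub>M\<^esub>}"
    note NM = submodule_carrier[OF N]
    have NI: "x = \<zero>\<^bsub>M\<^esub>" if "x \<in> N" "x \<in> I" for x using that NIJ sub by blast
    \<comment> \<open>A map \<phi> : M -> f(N) lifts to \<psi> : M -> N with f \<psi> = \<phi>. As
      f(x) lies in \<open>I\<close>, full invariance puts \<psi>(f(x)) in both N and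
      \<open>I\<close>, so it is zero and \<phi>(f(x)) = 0. This holds for all \<phi>, so f(x) = 0;
      hence N lies in \<open>J\<close> and is zero.\<close>
    have "f x = \<zero>\<^bsub>M\<^esub>" if x: "x \<in> N" and f: "f \<in> Hom R M M" "f ` carrier M \<subseteq> I" for f x
    proof -
      have "f x \<in> {\<zero>\<^bsub>M\<^esub>}"
      proof (rule mem_if_Hom_images_mem[OF _ _ zero_submodule])
        show "submodule (f ` N) R M"
          by (rule image_submodule[OF left_module_axioms left_module_axioms f(1) N])
        show "f x \<in> f ` N" using x by simp
        fix \<phi> assume \<phi>: "\<phi> \<in> Hom R M M" "\<phi> ` carrier M \<subseteq> f ` N"
        then have "\<phi> ` carrier M \<subseteq> restrict f N ` N" by simp
        then obtain \<psi> where \<psi>: "\<psi> \<in> Hom R M M" "\<psi> ` carrier M \<subseteq> N"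
          "\<And>y. y \<in> carrier M \<Longrightarrow> restrict f N (\<psi> y) = \<phi> y"
          using lift_Hom[OF N left_module_axioms restrict_Hom[OF left_module_axioms N f(1)] \<phi>(1)]
          by metis
        have fx: "f x \<in> carrier M" "f x \<in> I" using f NM[OF x] Hom_closed[OF f(1)] by auto
        then have "\<psi> (f x) \<in> N" "\<psi> (f x) \<in> I" using \<psi>(1,2) I'(2) by auto
        then have "\<psi> (f x) = \<zero>\<^bsub>M\<^esub>" by (rule NI)
        then show "\<phi> (f x) \<in> {\<zero>\<^bsub>M\<^esub>}"
          using \<psi>(3)[OF fx(1)] submodule_zero[OF N] Hom_zero[OF left_module_axioms left_module_axioms f(1)]
          by simp
      qed
      then show ?thesis by simp
    qed
    then have "N \<subseteq> J" using NM by (auto simp: J_def)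
    then show "N = {\<zero>\<^bsub>M\<^esub>}" using NIJ sub by blast
  qed
  then show ?thesis using that J IJ by blast
qed

text \<open>If N is not inside P, maximality gives N + P = M. Write x in K as a + b with a in N and
  b in P. Every f : M -> K maps a into the product, hence into P, and b into P by full invariance.
  So f(x) is in P for all such f, which forces x into P.\<close>

lemma maximal_fully_invariant_imp_prime:
  assumes "P \<in> maximal_fully_invariant R M"
  shows "prime_in R M P"
proof -
  have P: "fully_invariant R M P" "P \<noteq> carrier M"
    and max: "\<And>K. \<lbrakk>fully_invariant R M K; K \<noteq> carrier M; P \<subseteq> K\<rbrakk> \<Longrightarrow> K = P"
    using assms by (auto simp: maximal_fully_invariant_def)
  note P' = fully_invariantD[OF P(1)]
  have "K \<subseteq> P" if N: "fully_invariant R M N" and K: "fully_invariant R M K"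
    and NK: "module_prod R M N K \<subseteq> P" and "\<not> N \<subseteq> P" for N K
  proof
    note N' = fully_invariantD[OF N] and K' = fully_invariantD[OF K]
    have "N <+>\<^bsub>M\<^esub> P = carrier M"
      using max[OF fully_invariant_add[OF left_module_axioms N P(1)]]
        subset_add_submodule[OF N'(1) P'(1)] \<open>\<not> N \<subseteq> P\<close> by blast
    fix x assume x: "x \<in> K"
    then have "x \<in> N <+>\<^bsub>M\<^esub> P"
      using \<open>N <+>\<^bsub>M\<^esub> P = carrier M\<close> submodule_carrier[OF K'(1)] by simp
    then obtain a b where ab: "a \<in> N" "b \<in> P" "x = a \<oplus>\<^bsub>M\<^esub> b" by (auto simp: set_add_def')
    show "x \<in> P"
    proof (rule mem_if_Hom_images_mem[OF K'(1) x P'(1)])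
      fix f assume f: "f \<in> Hom R M M" "f ` carrier M \<subseteq> K"
      have "f a \<in> P"
        using NK[unfolded module_prod_subset_iff[OF left_module_axioms N'(1) K'(1) P'(1)]] f ab(1)
        by blast
      moreover have "f b \<in> P" using P'(2) f(1) ab(2) .
      ultimately show "f x \<in> P"
        using ab submodule_carrier[OF N'(1)] submodule_carrier[OF P'(1)] submodule_add[OF P'(1)]
        by (simp add: Hom_add[OF f(1)])
    qed
  qed
  then show ?thesis using P by (auto simp: prime_in_def)
qed

text \<open>A map M -> J carries Q into both Q and J, hence to zero, so the product of Q and J is
  zero and lies in every prime.\<close>

lemma prime_complement:
  assumes P: "prime_in R M P" and Q: "fully_invariant R M Q" and J: "fully_invariant R M J"
    and QJ: "Q \<inter> J = {\<zero>\<^bsub>M\<^esub>}"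
  shows "Q \<subseteq> P \<or> J \<subseteq> P"
proof -
  have P': "submodule P R M" using P by (auto simp: prime_in_def fully_invariant_def)
  note Q' = fully_invariantD[OF Q] and J' = fully_invariantD[OF J]
  have "module_prod R M Q J \<subseteq> P"
    unfolding module_prod_subset_iff[OF left_module_axioms Q'(1) J'(1) P']
  proof (intro ballI impI image_subsetI)
    fix f x assume "f \<in> Hom R M M" "f ` carrier M \<subseteq> J" "x \<in> Q"
    then have "f x \<in> Q \<inter> J" using Q'(2) submodule_carrier[OF Q'(1)] by auto
    then show "f x \<in> P" using QJ submodule_zero[OF P'] by simp
  qed
  then show ?thesis using P Q J by (auto simp: prime_in_def)
qed

text \<open>For a proper fully invariant Q above P split M = Q + J. If J were inside P, it would lie
  in Q and Q would be M. So primeness puts Q inside P.\<close>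

lemma prime_imp_maximal_fully_invariant:
  assumes Goldie: "Goldie_module R M" and P: "prime_in R M P"
  shows "P \<in> maximal_fully_invariant R M"
proof -
  have "Q = P" if Q: "fully_invariant R M Q" "Q \<noteq> carrier M" "P \<subseteq> Q" for Q
  proof -
    note Q' = fully_invariantD(1)[OF Q(1)]
    obtain J where J: "fully_invariant R M J" "Q \<inter> J = {\<zero>\<^bsub>M\<^esub>}" "Q <+>\<^bsub>M\<^esub> J = carrier M"
      by (rule fully_invariant_complement[OF Goldie Q(1)])
    have "\<not> J \<subseteq> P"
    proof
      assume "J \<subseteq> P"
      then have "Q <+>\<^bsub>M\<^esub> J \<subseteq> Q"
        using Q(3) submodule_add[OF Q'] by (auto simp: set_add_def')
      then show False using J(3) Q(2) submodule_subset[OF Q'] by blast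
    qed
    then show "Q = P" using prime_complement[OF P Q(1) J(1,2)] Q(3) by blast
  qed
  then show ?thesis using P by (auto simp: maximal_fully_invariant_def prime_in_def)
qed

text \<open>Infinitely many P_i would have nonzero complements U_i. For distinct i and j maximality
  keeps P_j out of P_i, so primeness puts U_j inside P_i. Thus the sum of all U_j with j other than
  i lies in P_i and meets U_i in zero, against finite uniform dimension.\<close>

lemma finite_maximal_fully_invariant:
  assumes Goldie: "Goldie_module R M"
  shows "finite (maximal_fully_invariant R M)"
proof (rule ccontr)
  assume "infinite (maximal_fully_invariant R M)"
  then obtain P :: "nat \<Rightarrow> 'm set" where inj: "inj P" and range: "range P \<subseteq> maximal_fully_invariant R M"
    using infinite_countable_subset by blast
  then have mem: "P i \<in> maximal_fully_invariant R M" for i by blast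
  then have P: "fully_invariant R M (P i)" "P i \<noteq> carrier M" "prime_in R M (P i)"
    and max: "\<And>K. \<lbrakk>fully_invariant R M K; K \<noteq> carrier M; P i \<subseteq> K\<rbrakk> \<Longrightarrow> K = P i" for i
    using maximal_fully_invariant_imp_prime[OF mem[of i]] mem[of i]
    by (simp_all add: maximal_fully_invariant_def)
  have "\<exists>J. fully_invariant R M J \<and> P i \<inter> J = {\<zero>\<^bsub>M\<^esub>} \<and> P i <+>\<^bsub>M\<^esub> J = carrier M" for i
    by (rule fully_invariant_complement[OF Goldie P(1)[of i]]) blast
  then obtain U where U: "\<And>i. fully_invariant R M (U i)" "\<And>i. P i \<inter> U i = {\<zero>\<^bsub>M\<^esub>}"
    "\<And>i. P i <+>\<^bsub>M\<^esub> U i = carrier M" by metis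
  note U' = fully_invariantD(1)[OF U(1)] and P' = fully_invariantD(1)[OF P(1)]
  have "U i \<noteq> {\<zero>\<^bsub>M\<^esub>}" for i
  proof
    assume "U i = {\<zero>\<^bsub>M\<^esub>}"
    then have "P i <+>\<^bsub>M\<^esub> U i \<subseteq> P i"
      using submodule_carrier[OF P'] by (auto simp: set_add_def')
    then show False using U(3) P(2)[of i] submodule_subset[OF P'] by blast
  qed
  moreover have "U i \<inter> sum_submodules M (- {i}) U = {\<zero>\<^bsub>M\<^esub>}" for i
  proof
    have "U j \<subseteq> P i" if "j \<noteq> i" for j
    proof -
      have "\<not> P j \<subseteq> P i"
        using max[OF P(1) P(2), of j i] that by (metis injD[OF inj])
      then show ?thesis using prime_complement[OF P(3) P(1) U(1) U(2), of j i] by simp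
    qed
    then have "sum_submodules M (- {i}) U \<subseteq> P i"
      by (subst sum_submodules_subset_iff[OF left_module_axioms P' submodule_subset[OF U']]) simp
    then show "U i \<inter> sum_submodules M (- {i}) U \<subseteq> {\<zero>\<^bsub>M\<^esub>}" using U(2) by blast
    have "\<zero>\<^bsub>M\<^esub> \<in> sum_submodules M (- {i}) U"
      by (rule zero_mem_sum_submodules[OF left_module_axioms])
    then show "{\<zero>\<^bsub>M\<^esub>} \<subseteq> U i \<inter> sum_submodules M (- {i}) U"
      using submodule_zero[OF U'] by simp
  qed
  ultimately have "\<not> finite_uniform_dimension R M"
    using U' unfolding finite_uniform_dimension_def by blast
  then show False using Goldie by (simp add: Goldie_module_def)
qed

end

theorem corollary4p8:
  fixes R :: "('r, 'x) ring_scheme" and M :: "('r, 'm) module"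
  assumes "ring R" and "left_module R M"
    and "projective_in_sigma TYPE((nat \<Rightarrow> 'm) set) R M"
    and "co_semisimple TYPE((nat \<Rightarrow> 'm) set) R M"
    and "Goldie_module R M"
  shows "maximal_fully_invariant R M = minimal_primes R M \<and>
    finite (minimal_primes R M) \<and> Spec_module R M = minimal_primes R M"
proof -
  interpret left_module R M by fact
  interpret projective_co_semisimple R M
    by unfold_locales (fact assms)+
  have Spec: "Spec_module R M = maximal_fully_invariant R M"
    using maximal_fully_invariant_imp_prime prime_imp_maximal_fully_invariant[OF assms(5)]
    by (auto simp: Spec_module_def)
  \<comment> \<open>All primes are maximal fully invariant, so none properly contains another and
    each is minimal.\<close>
  moreover have "minimal_primes R M = Spec_module R M"
    unfolding minimal_primes_def Spec by (auto simp: maximal_fully_invariant_def)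
  ultimately show ?thesis using finite_maximal_fully_invariant[OF assms(5)] by simp
qed

end
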